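(* Let $\mathcal{C}$ be a small category, let $\underline{A}$ be a unital commutative C*-algebra in $[\mathcal{C},\mathbf{Set}]$, and let $\Sigma_{\underline{A}}\to[\mathcal{C},\mathbf{Set}]$ be the localic geometric morphism corresponding to its internal Gelfand spectrum. Then the opens of $\Sigma_{\underline{A}}$ (equivalently: the opens of the localic reflection $\mathcal{L}(\Sigma_{\underline{A}})$) can be geometrically described as the elements $U\in\prod_{C\in\mathcal{C}_0}\mathcal{O}\Sigma_{\underline{A}(C)}$ such that if $f:C\to D$ is a morphism in $\mathcal{C}$, then $\Sigma_{\underline{A}(f)}^{*}(U_{C})\le U_{D}$.
   Context: An internal unital commutative C*-algebra in $[\mathcal{C},\mathbf{Set}]$ is a functor $\underline{A}$ from $\mathcal{C}$ to unital commutative C*-algebras and unital $*$-homomorphisms. $\Sigma_{\underline{A}}$ denotes the topos of internal sheaves on the internal Gelfand spectrum $\underline{\Sigma}_{\underline{A}}$, which is not localic in general. The opens of a topos $\mathcal{E}$ are the geometric morphisms $\mathcal{E}\to\mathbb{S}$ to the (sheaf topos of the) Sierpiński locale, equivalently the subobjects of $1$ in $\mathcal{E}$; they are the opens of the localic reflection $\mathcal{L}(\mathcal{E})$, obtained from the hyperconnected–localic factorization of $\mathcal{E}\to\mathbf{Set}$. For a unital commutative C*-algebra $B$, $\Sigma_B$ is its Gelfand spectrum, a compact regular locale with frame of opens $\mathcal{O}\Sigma_B$; a unital $*$-homomorphism $g:B\to B'$ induces a locale map $\Sigma_g:\Sigma_{B'}\to\Sigma_B$ with inverse image frame homomorphism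 $\Sigma_g^*:\mathcal{O}\Sigma_B\to\mathcal{O}\Sigma_{B'}$. Explicitly, with $B_{sa}$ ordered by $a\leq b$ iff $b-a$ is a square of a self-adjoint element, let $L_B$ be the distributive lattice presented by generators $D(a)$ ($a\in B_{sa}$) and relations $D(a)\wedge D(-a)=\bot$; $D(a)=\bot$ if $a\le0$; $D(a+b)\le D(a)\vee D(b)$; $D(1)=\top$; $D(ab)=(D(a)\wedge D(b))\vee(D(-a)\wedge D(-b))$. Write $a'\eqslantless a$ if there is $y$ with $a\vee y=\top$, $a'\wedge y=\bot$. Then $\Sigma_B=\mathrm{RSpec}\,L_B$ is the locale whose points are the regular prime filters of $L_B$, i.e. prime filters $x$ such that $a\in x$ implies $a'\in x$ for some $a'\eqslantless a$, and $\Sigma_g(y)=L_g^{-1}(y)$ where $L_g(D(a))=D(g(a))$. The internal spectrum is obtained by the same construction internally in $[\mathcal{C},\mathbf{Set}]$, with internal lattice $C\mapsto L_{\underline{A}(C)}$. *)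

theory Defs
  imports Complex_Main "HOL-Algebra.Module" "HOL-Algebra.Lattice" "HOL-Library.FuncSet"
begin

text \<open>Smallness is automatic, since objects and arrows form sets.
  \<open>Comp CC g f\<close> is the composite \<open>g\<close> after \<open>f\<close>.\<close>

record ('o, 'm) category =
  Obj :: "'o set"
  Arr :: "'m set"
  Dom :: "'m \<Rightarrow> 'o"
  Cod :: "'m \<Rightarrow> 'o"
  Id :: "'o \<Rightarrow> 'm"
  Comp :: "'m \<Rightarrow> 'm \<Rightarrow> 'm"

locale small_category =
  fixes CC :: "('o, 'm) category"
  assumes dom_cod: "f \<in> Arr CC \<Longrightarrow> Dom CC f \<in> Obj CC \<and> Cod CC f \<in> Obj CC"
    and id_arr: "C \<in> Obj CC \<Longrightarrow> Id CC C \<in> Arr CC \<and> Dom CC (Id CC C) = C \<and> Cod CC (Id CC C) = C"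
    and comp_arr: "\<lbrakk>f \<in> Arr CC; g \<in> Arr CC; Cod CC f = Dom CC g\<rbrakk> \<Longrightarrow>
      Comp CC g f \<in> Arr CC \<and> Dom CC (Comp CC g f) = Dom CC f \<and> Cod CC (Comp CC g f) = Cod CC g"
    and id_left: "f \<in> Arr CC \<Longrightarrow> Comp CC (Id CC (Cod CC f)) f = f"
    and id_right: "f \<in> Arr CC \<Longrightarrow> Comp CC f (Id CC (Dom CC f)) = f"
    and comp_assoc: "\<lbrakk>f \<in> Arr CC; g \<in> Arr CC; h \<in> Arr CC; Cod CC f = Dom CC g; Cod CC g = Dom CC h\<rbrakk> \<Longrightarrow>
      Comp CC h (Comp CC g f) = Comp CC (Comp CC h g) f"

definition arrows_from :: "('o, 'm) category \<Rightarrow> 'o \<Rightarrow> 'm set" where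
  "arrows_from CC C = {f \<in> Arr CC. Dom CC f = C}"

definition complex_ring :: "complex ring" where
  "complex_ring = \<lparr>carrier = UNIV, mult = (*), one = 1, zero = 0, add = (+)\<rparr>"

record 'a cstar = "(complex, 'a) module" +
  star :: "'a \<Rightarrow> 'a"
  nrm :: "'a \<Rightarrow> real"

text \<open>The zero algebra is admitted: \<open>nrm B \<one>\<^bsub>B\<^esub> = 1\<close> follows from the axioms in all other cases.\<close>

locale unital_comm_cstar = algebra complex_ring B for B :: "'a cstar" (structure) +
  assumes star_closed: "x \<in> carrier B \<Longrightarrow> star B x \<in> carrier B"
    and star_star: "x \<in> carrier B \<Longrightarrow> star B (star B x) = x"
    and star_add: "\<lbrakk>x \<in> carrier B; y \<in> carrier B\<rbrakk> \<Longrightarrow> star B (x \<oplus>\<^bsub>B\<^esub> y) = star B x \<oplus>\<^bsub>B\<^esub> star B y"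
    and star_mult: "\<lbrakk>x \<in> carrier B; y \<in> carrier B\<rbrakk> \<Longrightarrow> star B (x \<otimes>\<^bsub>B\<^esub> y) = star B y \<otimes>\<^bsub>B\<^esub> star B x"
    and star_smult: "x \<in> carrier B \<Longrightarrow> star B (c \<odot>\<^bsub>B\<^esub> x) = cnj c \<odot>\<^bsub>B\<^esub> star B x"
    and nrm_nonneg: "x \<in> carrier B \<Longrightarrow> 0 \<le> nrm B x"
    and nrm_eq_0: "x \<in> carrier B \<Longrightarrow> nrm B x = 0 \<longleftrightarrow> x = \<zero>\<^bsub>B\<^esub>"
    and nrm_triangle: "\<lbrakk>x \<in> carrier B; y \<in> carrier B\<rbrakk> \<Longrightarrow> nrm B (x \<oplus>\<^bsub>B\<^esub> y) \<le> nrm B x + nrm B y"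
    and nrm_smult: "x \<in> carrier B \<Longrightarrow> nrm B (c \<odot>\<^bsub>B\<^esub> x) = cmod c * nrm B x"
    and nrm_mult: "\<lbrakk>x \<in> carrier B; y \<in> carrier B\<rbrakk> \<Longrightarrow> nrm B (x \<otimes>\<^bsub>B\<^esub> y) \<le> nrm B x * nrm B y"
    and cstar_identity: "x \<in> carrier B \<Longrightarrow> nrm B (star B x \<otimes>\<^bsub>B\<^esub> x) = (nrm B x)\<^sup>2"
    and complete: "\<lbrakk>\<And>n. X n \<in> carrier B;
        \<And>e. 0 < e \<Longrightarrow> \<exists>N. \<forall>m\<ge>N. \<forall>n\<ge>N. nrm B (X m \<ominus>\<^bsub>B\<^esub> X n) < e\<rbrakk> \<Longrightarrow>
      \<exists>x\<in>carrier B. (\<lambda>n. nrm B (X n \<ominus>\<^bsub>B\<^esub> x)) \<longlonglongrightarrow> 0"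

definition star_hom :: "'a cstar \<Rightarrow> 'b cstar \<Rightarrow> ('a \<Rightarrow> 'b) set" where
  "star_hom B B' = {g \<in> ring_hom B B'.
     (\<forall>x\<in>carrier B. \<forall>c. g (c \<odot>\<^bsub>B\<^esub> x) = c \<odot>\<^bsub>B'\<^esub> g x) \<and>
     (\<forall>x\<in>carrier B. g (star B x) = star B' (g x))}"

text \<open>A unital commutative C*-algebra in \<open>[CC, Set]\<close>: a functor with object part \<open>A\<close> and
  arrow part \<open>\<alpha>\<close>.\<close>

locale cstar_functor = small_category CC for CC :: "('o, 'm) category" +
  fixes A :: "'o \<Rightarrow> 'a cstar" and \<alpha> :: "'m \<Rightarrow> 'a \<Rightarrow> 'a"
  assumes algebra_obj: "C \<in> Obj CC \<Longrightarrow> unital_comm_cstar (A C)"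
    and hom_arr: "f \<in> Arr CC \<Longrightarrow> \<alpha> f \<in> star_hom (A (Dom CC f)) (A (Cod CC f))"
    and map_id: "\<lbrakk>C \<in> Obj CC; x \<in> carrier (A C)\<rbrakk> \<Longrightarrow> \<alpha> (Id CC C) x = x"
    and map_comp: "\<lbrakk>f \<in> Arr CC; g \<in> Arr CC; Cod CC f = Dom CC g; x \<in> carrier (A (Dom CC f))\<rbrakk> \<Longrightarrow>
      \<alpha> (Comp CC g f) x = \<alpha> g (\<alpha> f x)"

definition sa :: "'a cstar \<Rightarrow> 'a set" where
  "sa B = {x \<in> carrier B. star B x = x}"

definition sa_le :: "'a cstar \<Rightarrow> 'a \<Rightarrow> 'a \<Rightarrow> bool" where
  "sa_le B a b \<longleftrightarrow> (\<exists>c\<in>sa B. b \<ominus>\<^bsub>B\<^esub> a = c \<otimes>\<^bsub>B\<^esub> c)"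

datatype 'a lterm = D 'a | LTop | LBot | LMeet "'a lterm" "'a lterm" | LJoin "'a lterm" "'a lterm"

definition lterms :: "'a cstar \<Rightarrow> 'a lterm set" where
  "lterms B = {t. set_lterm t \<subseteq> sa B}"

text \<open>\<open>Lat B\<close> below is the distributive lattice \<open>L\<^sub>B\<close> presented by generators \<open>D a\<close>: the quotient of
  the terms by the least preorder that makes them a bounded distributive lattice (up to mutual
  inequality) and satisfies the relations.\<close>

inductive lterm_le :: "'a cstar \<Rightarrow> 'a lterm \<Rightarrow> 'a lterm \<Rightarrow> bool" for B where
  refl: "t \<in> lterms B \<Longrightarrow> lterm_le B t t"
| trans: "\<lbrakk>lterm_le B r s; lterm_le B s t\<rbrakk> \<Longrightarrow> lterm_le B r t"
| top: "t \<in> lterms B \<Longrightarrow> lterm_le B t LTop"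
| bot: "t \<in> lterms B \<Longrightarrow> lterm_le B LBot t"
| meet1: "\<lbrakk>s \<in> lterms B; t \<in> lterms B\<rbrakk> \<Longrightarrow> lterm_le B (LMeet s t) s"
| meet2: "\<lbrakk>s \<in> lterms B; t \<in> lterms B\<rbrakk> \<Longrightarrow> lterm_le B (LMeet s t) t"
| meetI: "\<lbrakk>lterm_le B r s; lterm_le B r t\<rbrakk> \<Longrightarrow> lterm_le B r (LMeet s t)"
| join1: "\<lbrakk>s \<in> lterms B; t \<in> lterms B\<rbrakk> \<Longrightarrow> lterm_le B s (LJoin s t)"
| join2: "\<lbrakk>s \<in> lterms B; t \<in> lterms B\<rbrakk> \<Longrightarrow> lterm_le B t (LJoin s t)"
| joinE: "\<lbrakk>lterm_le B s r; lterm_le B t r\<rbrakk> \<Longrightarrow> lterm_le B (LJoin s t) r"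
| distrib: "\<lbrakk>r \<in> lterms B; s \<in> lterms B; t \<in> lterms B\<rbrakk> \<Longrightarrow>
    lterm_le B (LMeet r (LJoin s t)) (LJoin (LMeet r s) (LMeet r t))"
| D_disjoint: "a \<in> sa B \<Longrightarrow> lterm_le B (LMeet (D a) (D (\<ominus>\<^bsub>B\<^esub> a))) LBot"
| D_nonpos: "\<lbrakk>a \<in> sa B; sa_le B a \<zero>\<^bsub>B\<^esub>\<rbrakk> \<Longrightarrow> lterm_le B (D a) LBot"
| D_add: "\<lbrakk>a \<in> sa B; b \<in> sa B\<rbrakk> \<Longrightarrow> lterm_le B (D (a \<oplus>\<^bsub>B\<^esub> b)) (LJoin (D a) (D b))"
| D_one: "lterm_le B LTop (D \<one>\<^bsub>B\<^esub>)"
| D_mult1: "\<lbrakk>a \<in> sa B; b \<in> sa B\<rbrakk> \<Longrightarrow> lterm_le B (D (a \<otimes>\<^bsub>B\<^esub> b))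
    (LJoin (LMeet (D a) (D b)) (LMeet (D (\<ominus>\<^bsub>B\<^esub> a)) (D (\<ominus>\<^bsub>B\<^esub> b))))"
| D_mult2: "\<lbrakk>a \<in> sa B; b \<in> sa B\<rbrakk> \<Longrightarrow> lterm_le B
    (LJoin (LMeet (D a) (D b)) (LMeet (D (\<ominus>\<^bsub>B\<^esub> a)) (D (\<ominus>\<^bsub>B\<^esub> b)))) (D (a \<otimes>\<^bsub>B\<^esub> b))"

definition lclass :: "'a cstar \<Rightarrow> 'a lterm \<Rightarrow> 'a lterm set" where
  "lclass B t = {s. lterm_le B s t \<and> lterm_le B t s}"

definition Lat :: "'a cstar \<Rightarrow> 'a lterm set gorder" where
  "Lat B = \<lparr>carrier = lclass B ` lterms B, eq = (=),
            le = (\<lambda>X Y. \<exists>s\<in>X. \<exists>t\<in>Y. lterm_le B s t)\<rparr>"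

text \<open>\<open>L\<^sub>g\<close>: the class of \<open>t\<close> is sent to the class of \<open>t\<close> with \<open>g\<close> applied to all generators.\<close>

definition Lat_map :: "'b cstar \<Rightarrow> ('a \<Rightarrow> 'b) \<Rightarrow> 'a lterm set \<Rightarrow> 'b lterm set" where
  "Lat_map B' g X = (\<Union>t\<in>X. lclass B' (map_lterm g t))"

definition rather_below :: "'l gorder \<Rightarrow> 'l \<Rightarrow> 'l \<Rightarrow> bool" where
  "rather_below L a' a \<longleftrightarrow> a' \<in> carrier L \<and> a \<in> carrier L \<and>
     (\<exists>y\<in>carrier L. a \<squnion>\<^bsub>L\<^esub> y = \<top>\<^bsub>L\<^esub> \<and> a' \<sqinter>\<^bsub>L\<^esub> y = \<bottom>\<^bsub>L\<^esub>)"

definition regular_prime_filter :: "'l gorder \<Rightarrow> 'l set \<Rightarrow> bool" where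
  "regular_prime_filter L x \<longleftrightarrow> x \<subseteq> carrier L \<and> \<top>\<^bsub>L\<^esub> \<in> x \<and> \<bottom>\<^bsub>L\<^esub> \<notin> x \<and>
     (\<forall>a\<in>x. \<forall>b\<in>carrier L. a \<sqsubseteq>\<^bsub>L\<^esub> b \<longrightarrow> b \<in> x) \<and>
     (\<forall>a\<in>x. \<forall>b\<in>x. a \<sqinter>\<^bsub>L\<^esub> b \<in> x) \<and>
     (\<forall>a\<in>carrier L. \<forall>b\<in>carrier L. a \<squnion>\<^bsub>L\<^esub> b \<in> x \<longrightarrow> a \<in> x \<or> b \<in> x) \<and>
     (\<forall>a\<in>x. \<exists>a'\<in>x. rather_below L a' a)"

text \<open>The frame of \<open>RSpec L\<close>, i.e. the frame presented by the propositional geometric theory of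
  regular prime filters. With the meet-semilattice of generators \<open>L\<close>, the remaining axioms of that
  theory say that \<open>\<bottom>\<close> is covered by the empty family, \<open>a \<squnion> b\<close> by \<open>{a, b}\<close>, and \<open>a\<close> by
  \<open>{a'. rather_below L a' a}\<close>. Closing the last of these under meets with an arbitrary \<open>b\<close> makes it
  a coverage, and the presented frame consists of its C-ideals, ordered by inclusion.\<close>

definition rspec_opens :: "'l gorder \<Rightarrow> 'l set set" where
  "rspec_opens L = {U. U \<subseteq> carrier L \<and>
     (\<forall>a\<in>U. \<forall>b\<in>carrier L. b \<sqsubseteq>\<^bsub>L\<^esub> a \<longrightarrow> b \<in> U) \<and>
     \<bottom>\<^bsub>L\<^esub> \<in> U \<and>
     (\<forall>a\<in>U. \<forall>b\<in>U. a \<squnion>\<^bsub>L\<^esub> b \<in> U) \<and>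
     (\<forall>a\<in>carrier L. \<forall>b\<in>carrier L.
        (\<forall>a'. rather_below L a' a \<longrightarrow> a' \<sqinter>\<^bsub>L\<^esub> b \<in> U) \<longrightarrow> a \<sqinter>\<^bsub>L\<^esub> b \<in> U)}"

definition rspec_gen :: "'l gorder \<Rightarrow> 'l set \<Rightarrow> 'l set" where
  "rspec_gen L S = \<Inter> {V \<in> rspec_opens L. S \<subseteq> V}"

text \<open>The inverse image along the map \<open>y \<mapsto> h\<^sup>-\<^sup>1(y)\<close> from \<open>RSpec L'\<close> to \<open>RSpec L\<close>, for a
  lattice homomorphism \<open>h\<close> from \<open>L\<close> to \<open>L'\<close>: the join of the basic opens given by \<open>h a\<close>
  with \<open>a \<in> U\<close>. See \<open>rspec_inv_image_points\<close> below.\<close>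

definition rspec_inv_image :: "'l' gorder \<Rightarrow> ('l \<Rightarrow> 'l') \<Rightarrow> 'l set \<Rightarrow> 'l' set" where
  "rspec_inv_image L' h U = rspec_gen L' (h ` U)"

lemma rspec_gen_points:
  assumes L: "lattice L" and x: "regular_prime_filter L x" and S: "S \<subseteq> carrier L"
  shows "rspec_gen L S \<inter> x \<noteq> {} \<longleftrightarrow> S \<inter> x \<noteq> {}"
proof -
  interpret lattice L by (rule L)
  let ?V = "carrier L - x"
  have xc: "x \<subseteq> carrier L" using x by (auto simp: regular_prime_filter_def)
  have up: "b \<in> x" if "a \<in> x" "b \<in> carrier L" "a \<sqsubseteq>\<^bsub>L\<^esub> b" for a b
    using x that by (auto simp: regular_prime_filter_def)
  have bot: "\<bottom>\<^bsub>L\<^esub> \<in> ?V"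
  proof -
    obtain b where "b \<in> x" "rather_below L b \<top>\<^bsub>L\<^esub>"
      using x by (auto simp: regular_prime_filter_def)
    then obtain y where "b \<in> carrier L" "y \<in> carrier L" "b \<sqinter>\<^bsub>L\<^esub> y = \<bottom>\<^bsub>L\<^esub>"
      by (auto simp: rather_below_def)
    then have "\<bottom>\<^bsub>L\<^esub> \<in> carrier L" by (metis meet_closed)
    then show ?thesis using x by (auto simp: regular_prime_filter_def)
  qed
  have cover: "a \<sqinter>\<^bsub>L\<^esub> b \<in> ?V" if ab: "a \<in> carrier L" "b \<in> carrier L"
    and *: "\<forall>a'. rather_below L a' a \<longrightarrow> a' \<sqinter>\<^bsub>L\<^esub> b \<in> ?V" for a b
  proof (rule ccontr)
    assume "a \<sqinter>\<^bsub>L\<^esub> b \<notin> ?V"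
    then have "a \<sqinter>\<^bsub>L\<^esub> b \<in> x" using ab by auto
    then have "a \<in> x" "b \<in> x" using up ab meet_left meet_right by blast+
    then obtain a' where "a' \<in> x" "rather_below L a' a"
      using x by (auto simp: regular_prime_filter_def)
    then have "a' \<sqinter>\<^bsub>L\<^esub> b \<in> x" using x \<open>b \<in> x\<close> by (auto simp: regular_prime_filter_def)
    then show False using * \<open>rather_below L a' a\<close> by auto
  qed
  have join: "a \<squnion>\<^bsub>L\<^esub> b \<in> ?V" if "a \<in> ?V" "b \<in> ?V" for a b
    using x that by (auto simp: regular_prime_filter_def)
  have V: "?V \<in> rspec_opens L"
    unfolding rspec_opens_def mem_Collect_eq
    by (intro conjI ballI impI) (use bot cover join up in blast)+
  have "S \<subseteq> rspec_gen L S" by (auto simp: rspec_gen_def)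
  moreover have "rspec_gen L S \<inter> x = {}" if "S \<inter> x = {}"
  proof -
    have "S \<subseteq> ?V" using S that by auto
    then show ?thesis using V by (auto simp: rspec_gen_def)
  qed
  ultimately show ?thesis by blast
qed

lemma rspec_inv_image_points:
  assumes "lattice L'" and "regular_prime_filter L' y"
    and "h \<in> carrier L \<rightarrow> carrier L'" and "U \<in> rspec_opens L"
  shows "rspec_inv_image L' h U \<inter> y \<noteq> {} \<longleftrightarrow> U \<inter> {a \<in> carrier L. h a \<in> y} \<noteq> {}"
proof -
  have "U \<subseteq> carrier L" using assms(4) by (auto simp: rspec_opens_def)
  then have "h ` U \<subseteq> carrier L'" using assms(3) by auto
  then show ?thesis
    using rspec_gen_points[OF assms(1,2)] \<open>U \<subseteq> carrier L\<close>
    by (auto simp: rspec_inv_image_def)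
qed

text \<open>An internal lattice of \<open>[CC, Set]\<close> is a functor \<open>C \<mapsto> L C\<close> with arrow part \<open>h\<close>. The
  construction of \<open>rspec_opens\<close> is carried out internally. At stage \<open>C\<close>, an element of the internal
  powerset of \<open>L\<close> is a family of subsets \<open>I f \<subseteq> L (Cod f)\<close>, indexed by the arrows \<open>f\<close> from \<open>C\<close> and
  stable under the transition maps; arrows not from \<open>C\<close> are sent to \<open>{}\<close>. The last four conditions
  below are the Kripke-Joyal readings of those in \<open>rspec_opens\<close>: the universally quantified premise
  of the last one ranges over all later stages \<open>g\<close>, whereas the quantification over later stages is
  redundant in the others (and the existential in \<open>rather_below\<close> is stagewise).\<close>

definition int_rspec_opens ::
  "('o, 'm) category \<Rightarrow> ('o \<Rightarrow> 'l gorder) \<Rightarrow> ('m \<Rightarrow> 'l \<Rightarrow> 'l) \<Rightarrow> 'o \<Rightarrow> ('m \<Rightarrow> 'l set) set" where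
  "int_rspec_opens CC L h C = {I.
     (\<forall>f. f \<notin> arrows_from CC C \<longrightarrow> I f = {}) \<and>
     (\<forall>f\<in>arrows_from CC C. I f \<subseteq> carrier (L (Cod CC f)) \<and>
        (\<forall>g\<in>arrows_from CC (Cod CC f). \<forall>a\<in>I f. h g a \<in> I (Comp CC g f))) \<and>
     (\<forall>f\<in>arrows_from CC C. let M = L (Cod CC f) in
        (\<forall>a\<in>I f. \<forall>b\<in>carrier M. b \<sqsubseteq>\<^bsub>M\<^esub> a \<longrightarrow> b \<in> I f) \<and>
        \<bottom>\<^bsub>M\<^esub> \<in> I f \<and>
        (\<forall>a\<in>I f. \<forall>b\<in>I f. a \<squnion>\<^bsub>M\<^esub> b \<in> I f) \<and>
        (\<forall>a\<in>carrier M. \<forall>b\<in>carrier M.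
           (\<forall>g\<in>arrows_from CC (Cod CC f). \<forall>a'. rather_below (L (Cod CC g)) a' (h g a) \<longrightarrow>
              a' \<sqinter>\<^bsub>L (Cod CC g)\<^esub> h g b \<in> I (Comp CC g f))
           \<longrightarrow> a \<sqinter>\<^bsub>M\<^esub> b \<in> I f))}"

definition int_rspec ::
  "('o, 'm) category \<Rightarrow> ('o \<Rightarrow> 'l gorder) \<Rightarrow> ('m \<Rightarrow> 'l \<Rightarrow> 'l) \<Rightarrow> 'o \<Rightarrow> ('m \<Rightarrow> 'l set) gorder" where
  "int_rspec CC L h C =
     \<lparr>carrier = int_rspec_opens CC L h C, eq = (=), le = (\<lambda>I J. \<forall>f. I f \<subseteq> J f)\<rparr>"

definition int_rspec_map :: "('o, 'm) category \<Rightarrow> 'm \<Rightarrow> ('m \<Rightarrow> 'l set) \<Rightarrow> 'm \<Rightarrow> 'l set" where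
  "int_rspec_map CC f I = (\<lambda>g. if g \<in> arrows_from CC (Cod CC f) then I (Comp CC g f) else {})"

text \<open>Throughout, \<open>F\<close> and \<open>t\<close> are the object and arrow parts of an internal frame of \<open>[CC, Set]\<close>.
  An internal presheaf on \<open>F\<close> consists of sets \<open>sec X C u\<close> (\<open>u \<in> F C\<close>) with restrictions
  \<open>res X C u v\<close> from \<open>u\<close> to \<open>v \<sqsubseteq> u\<close>, and transition maps \<open>tr X f u\<close> along the arrows \<open>f\<close> of \<open>CC\<close>.\<close>

record ('o, 'm, 'u, 'x) int_presheaf =
  sec :: "'o \<Rightarrow> 'u \<Rightarrow> 'x set"
  res :: "'o \<Rightarrow> 'u \<Rightarrow> 'u \<Rightarrow> 'x \<Rightarrow> 'x"
  tr :: "'m \<Rightarrow> 'u \<Rightarrow> 'x \<Rightarrow> 'x"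

locale internal_presheaf =
  fixes CC :: "('o, 'm) category" and F :: "'o \<Rightarrow> 'u gorder" and t :: "'m \<Rightarrow> 'u \<Rightarrow> 'u"
    and X :: "('o, 'm, 'u, 'x) int_presheaf"
  assumes res_closed: "\<lbrakk>C \<in> Obj CC; u \<in> carrier (F C); v \<in> carrier (F C); v \<sqsubseteq>\<^bsub>F C\<^esub> u; x \<in> sec X C u\<rbrakk> \<Longrightarrow>
      res X C u v x \<in> sec X C v"
    and res_id: "\<lbrakk>C \<in> Obj CC; u \<in> carrier (F C); x \<in> sec X C u\<rbrakk> \<Longrightarrow> res X C u u x = x"
    and res_res: "\<lbrakk>C \<in> Obj CC; u \<in> carrier (F C); v \<in> carrier (F C); w \<in> carrier (F C);
      v \<sqsubseteq>\<^bsub>F C\<^esub> u; w \<sqsubseteq>\<^bsub>F C\<^esub> v; x \<in> sec X C u\<rbrakk> \<Longrightarrow> res X C v w (res X C u v x) = res X C u w x"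
    and tr_closed: "\<lbrakk>f \<in> Arr CC; u \<in> carrier (F (Dom CC f)); x \<in> sec X (Dom CC f) u\<rbrakk> \<Longrightarrow>
      tr X f u x \<in> sec X (Cod CC f) (t f u)"
    and tr_id: "\<lbrakk>C \<in> Obj CC; u \<in> carrier (F C); x \<in> sec X C u\<rbrakk> \<Longrightarrow> tr X (Id CC C) u x = x"
    and tr_comp: "\<lbrakk>f \<in> Arr CC; g \<in> Arr CC; Cod CC f = Dom CC g; u \<in> carrier (F (Dom CC f));
      x \<in> sec X (Dom CC f) u\<rbrakk> \<Longrightarrow> tr X (Comp CC g f) u x = tr X g (t f u) (tr X f u x)"
    and tr_res: "\<lbrakk>f \<in> Arr CC; u \<in> carrier (F (Dom CC f)); v \<in> carrier (F (Dom CC f));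
      v \<sqsubseteq>\<^bsub>F (Dom CC f)\<^esub> u; x \<in> sec X (Dom CC f) u\<rbrakk> \<Longrightarrow>
      tr X f v (res X (Dom CC f) u v x) = res X (Cod CC f) (t f u) (t f v) (tr X f u x)"

text \<open>A sieve \<open>S\<close> on \<open>u\<close> at stage \<open>C\<close> is a transition-stable family of down-closed sets \<open>S f\<close> of
  elements below \<open>t f u\<close>. It covers if \<open>u\<close> is the join of \<open>S\<close> in the internal frame, again in the
  Kripke-Joyal sense.\<close>

definition int_sieve ::
  "('o, 'm) category \<Rightarrow> ('o \<Rightarrow> 'u gorder) \<Rightarrow> ('m \<Rightarrow> 'u \<Rightarrow> 'u) \<Rightarrow> 'o \<Rightarrow> 'u \<Rightarrow> ('m \<Rightarrow> 'u set) \<Rightarrow> bool" where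
  "int_sieve CC F t C u S \<longleftrightarrow> (\<forall>f\<in>arrows_from CC C. let M = F (Cod CC f) in
     (\<forall>v\<in>S f. v \<in> carrier M \<and> v \<sqsubseteq>\<^bsub>M\<^esub> t f u \<and>
        (\<forall>w\<in>carrier M. w \<sqsubseteq>\<^bsub>M\<^esub> v \<longrightarrow> w \<in> S f) \<and>
        (\<forall>g\<in>arrows_from CC (Cod CC f). t g v \<in> S (Comp CC g f))))"

definition int_covers ::
  "('o, 'm) category \<Rightarrow> ('o \<Rightarrow> 'u gorder) \<Rightarrow> ('m \<Rightarrow> 'u \<Rightarrow> 'u) \<Rightarrow> 'o \<Rightarrow> 'u \<Rightarrow> ('m \<Rightarrow> 'u set) \<Rightarrow> bool" where
  "int_covers CC F t C u S \<longleftrightarrow> int_sieve CC F t C u S \<and>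
     (\<forall>f\<in>arrows_from CC C. \<forall>w\<in>carrier (F (Cod CC f)).
        (\<forall>g\<in>arrows_from CC (Cod CC f). \<forall>v\<in>S (Comp CC g f). v \<sqsubseteq>\<^bsub>F (Cod CC g)\<^esub> t g w)
        \<longrightarrow> t f u \<sqsubseteq>\<^bsub>F (Cod CC f)\<^esub> w)"

definition matching_family ::
  "('o, 'm) category \<Rightarrow> ('o \<Rightarrow> 'u gorder) \<Rightarrow> ('m \<Rightarrow> 'u \<Rightarrow> 'u) \<Rightarrow> ('o, 'm, 'u, 'x) int_presheaf \<Rightarrow>
   'o \<Rightarrow> ('m \<Rightarrow> 'u set) \<Rightarrow> ('m \<Rightarrow> 'u \<Rightarrow> 'x) \<Rightarrow> bool" where
  "matching_family CC F t X C S x \<longleftrightarrow> (\<forall>f\<in>arrows_from CC C. \<forall>v\<in>S f.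
     x f v \<in> sec X (Cod CC f) v \<and>
     (\<forall>w\<in>carrier (F (Cod CC f)). w \<sqsubseteq>\<^bsub>F (Cod CC f)\<^esub> v \<longrightarrow> res X (Cod CC f) v w (x f v) = x f w) \<and>
     (\<forall>g\<in>arrows_from CC (Cod CC f). tr X g v (x f v) = x (Comp CC g f) (t g v)))"

locale internal_sheaf = internal_presheaf CC F t X
  for CC :: "('o, 'm) category" and F :: "'o \<Rightarrow> 'u gorder" and t :: "'m \<Rightarrow> 'u \<Rightarrow> 'u"
    and X :: "('o, 'm, 'u, 'x) int_presheaf" +
  assumes glue: "\<lbrakk>C \<in> Obj CC; u \<in> carrier (F C); int_covers CC F t C u S;
      matching_family CC F t X C S x\<rbrakk> \<Longrightarrow>
    \<exists>!y. y \<in> sec X C u \<and>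
      (\<forall>f\<in>arrows_from CC C. \<forall>v\<in>S f. res X (Cod CC f) (t f u) v (tr X f u y) = x f v)"

definition terminal_sheaf :: "('o, 'm, 'u, unit) int_presheaf" where
  "terminal_sheaf = \<lparr>sec = (\<lambda>C u. UNIV), res = (\<lambda>C u v x. x), tr = (\<lambda>f u x. x)\<rparr>"

text \<open>The subobjects of a sheaf \<open>X\<close> in the topos of internal sheaves, each represented by the
  unique subsheaf of \<open>X\<close> in its isomorphism class; a subsheaf is given by its sets of sections
  (\<open>{}\<close> outside the domain of \<open>X\<close>), and the order on subobjects is inclusion.\<close>

definition subsheaves ::
  "('o, 'm) category \<Rightarrow> ('o \<Rightarrow> 'u gorder) \<Rightarrow> ('m \<Rightarrow> 'u \<Rightarrow> 'u) \<Rightarrow> ('o, 'm, 'u, 'x) int_presheaf \<Rightarrow>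
   ('o \<Rightarrow> 'u \<Rightarrow> 'x set) set" where
  "subsheaves CC F t X = {P.
     (\<forall>C u. (C \<in> Obj CC \<and> u \<in> carrier (F C) \<longrightarrow> P C u \<subseteq> sec X C u) \<and>
            (\<not> (C \<in> Obj CC \<and> u \<in> carrier (F C)) \<longrightarrow> P C u = {})) \<and>
     internal_sheaf CC F t (X\<lparr>sec := P\<rparr>)}"

definition topos_opens ::
  "('o, 'm) category \<Rightarrow> ('o \<Rightarrow> 'u gorder) \<Rightarrow> ('m \<Rightarrow> 'u \<Rightarrow> 'u) \<Rightarrow> ('o \<Rightarrow> 'u \<Rightarrow> unit set) set" where
  "topos_opens CC F t = subsheaves CC F t terminal_sheaf"

definition gelfand_frame ::
  "('o, 'm) category \<Rightarrow> ('o \<Rightarrow> 'a cstar) \<Rightarrow> ('m \<Rightarrow> 'a \<Rightarrow> 'a) \<Rightarrow> 'o \<Rightarrow> ('m \<Rightarrow> 'a lterm set set) gorder" where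
  "gelfand_frame CC A \<alpha> =
     int_rspec CC (\<lambda>C. Lat (A C)) (\<lambda>f. Lat_map (A (Cod CC f)) (\<alpha> f))"

definition gelfand_topos_opens ::
  "('o, 'm) category \<Rightarrow> ('o \<Rightarrow> 'a cstar) \<Rightarrow> ('m \<Rightarrow> 'a \<Rightarrow> 'a) \<Rightarrow>
   ('o \<Rightarrow> ('m \<Rightarrow> 'a lterm set set) \<Rightarrow> unit set) set" where
  "gelfand_topos_opens CC A \<alpha> = topos_opens CC (gelfand_frame CC A \<alpha>) (int_rspec_map CC)"

definition compatible_families ::
  "('o, 'm) category \<Rightarrow> ('o \<Rightarrow> 'a cstar) \<Rightarrow> ('m \<Rightarrow> 'a \<Rightarrow> 'a) \<Rightarrow> ('o \<Rightarrow> 'a lterm set set) set" where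
  "compatible_families CC A \<alpha> = {U \<in> (\<Pi>\<^sub>E C\<in>Obj CC. rspec_opens (Lat (A C))).
     \<forall>f\<in>Arr CC. rspec_inv_image (Lat (A (Cod CC f))) (Lat_map (A (Cod CC f)) (\<alpha> f)) (U (Dom CC f))
       \<subseteq> U (Cod CC f)}"

text \<open>The open described by a family \<open>U\<close>: it contains the internal open \<open>I\<close> at stage \<open>C\<close> iff
  \<open>I\<close> is below the restriction \<open>f \<mapsto> U (Cod f)\<close> of \<open>U\<close> to the arrows from \<open>C\<close>.\<close>

definition open_of_family ::
  "('o, 'm) category \<Rightarrow> ('o \<Rightarrow> 'a cstar) \<Rightarrow> ('m \<Rightarrow> 'a \<Rightarrow> 'a) \<Rightarrow> ('o \<Rightarrow> 'a lterm set set) \<Rightarrow>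
   'o \<Rightarrow> ('m \<Rightarrow> 'a lterm set set) \<Rightarrow> unit set" where
  "open_of_family CC A \<alpha> U C I =
     {x. C \<in> Obj CC \<and> I \<in> carrier (gelfand_frame CC A \<alpha> C) \<and>
         (\<forall>f\<in>arrows_from CC C. I f \<subseteq> U (Cod CC f))}"

end

theory Submission
  imports Defs
begin

text \<open>The elements of a stage of the internal frame are families of internal ideals whose
  regularity is tested at all later stages. For the Gelfand lattices it may be tested at the
  present stage only, because \<open>rather_below\<close> interpolates through the transition maps: let \<open>t\<^sub>r\<close>
  arise from a lattice term \<open>t\<close> by replacing each generator \<open>D a\<close> by \<open>D (a - r)\<close>. An induction on
  the derivation of \<open>s \<le> t\<close> shows that for every \<open>e > 0\<close> there is \<open>d > 0\<close> with \<open>s\<^sub>e \<le> t\<^sub>d\<close>; hence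
  whatever is rather below \<open>t\<close> is below some \<open>t\<^sub>r\<close>, and \<open>t\<^sub>r\<close> is itself rather below \<open>t\<close>. Since
  unital homomorphisms commute with \<open>t \<mapsto> t\<^sub>r\<close>, an element rather below \<open>L\<^sub>g a\<close> lies below \<open>L\<^sub>g a'\<close>
  for some \<open>a'\<close> rather below \<open>a\<close>.

  Consequently a compatible family restricts at every stage to an internal open. Conversely an open
  \<open>P\<close> of the topos is determined by its largest elements: the internal join of \<open>P\<close> is generated at
  stage \<open>C\<close> by the values at \<open>Id C\<close> of the elements of \<open>P C\<close>, and it belongs to \<open>P\<close> by gluing.\<close>

section \<open>Square roots and bounds in commutative C*-algebras\<close>

lemma complex_ring_simps [simp]:
  "carrier complex_ring = UNIV" "x \<otimes>\<^bsub>complex_ring\<^esub> y = x * y" "x \<oplus>\<^bsub>complex_ring\<^esub> y = x + y"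
  "\<one>\<^bsub>complex_ring\<^esub> = 1" "\<zero>\<^bsub>complex_ring\<^esub> = 0"
  by (simp_all add: complex_ring_def)

section \<open>Real scalars and the self-adjoint part\<close>

context unital_comm_cstar
begin

text \<open>Real scalars are kept as ring elements, so that identities mixing scalars and elements
  become identities in a commutative ring.\<close>

definition scal :: "real \<Rightarrow> 'a" where
  "scal r = complex_of_real r \<odot> \<one>"

lemma scal_closed [simp, intro]: "scal r \<in> carrier B"
  by (simp add: scal_def)

lemma scal_add: "scal (r + s) = scal r \<oplus> scal s"
  using smult_l_distr[of "complex_of_real r" "complex_of_real s" \<one>] by (simp add: scal_def)

lemma scal_0: "scal 0 = \<zero>"
  using smult_l_null[of \<one>] by (simp add: scal_def)

lemma scal_1: "scal 1 = \<one>"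
  using smult_one[of \<one>] by (simp add: scal_def)

lemma scal_smult: "x \<in> carrier B \<Longrightarrow> scal r \<otimes> x = complex_of_real r \<odot> x"
  using smult_assoc2[of "complex_of_real r" \<one> x] by (simp add: scal_def)

lemma scal_mult: "scal (r * s) = scal r \<otimes> scal s"
  using smult_assoc1[of "complex_of_real r" "complex_of_real s" \<one>] scal_smult[of "scal s" r]
  by (simp add: scal_def)

lemma scal_minus: "scal (- r) = \<ominus> scal r"
proof -
  have "scal (- r) \<oplus> scal r = \<zero>" using scal_add[of "- r" r] by (simp add: scal_0)
  then show ?thesis by (metis minus_equality scal_closed)
qed

lemma scal_diff: "scal (r - s) = scal r \<ominus> scal s"
  using scal_add[of r "- s"] by (simp add: scal_minus minus_eq)

lemma sa_closed [dest]: "a \<in> sa B \<Longrightarrow> a \<in> carrier B"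
  by (simp add: sa_def)

lemma star_one: "star B \<one> = \<one>"
proof -
  have "star B \<one> = star B (star B \<one> \<otimes> \<one>)"
    using star_mult[of "star B \<one>" \<one>] star_closed star_star by simp
  then show ?thesis using star_closed star_star by simp
qed

lemma scal_sa [simp, intro]: "scal r \<in> sa B"
  using star_smult[of \<one> "complex_of_real r"] star_one by (simp add: sa_def scal_def)

lemma one_sa [simp, intro]: "\<one> \<in> sa B"
  using scal_sa[of 1] by (simp only: scal_1)

lemma zero_sa [simp, intro]: "\<zero> \<in> sa B"
  using scal_sa[of 0] by (simp only: scal_0)

lemma add_sa [simp, intro]: "\<lbrakk>a \<in> sa B; b \<in> sa B\<rbrakk> \<Longrightarrow> a \<oplus> b \<in> sa B"
  using star_add by (simp add: sa_def)

lemma mult_sa [simp, intro]: "\<lbrakk>a \<in> sa B; b \<in> sa B\<rbrakk> \<Longrightarrow> a \<otimes> b \<in> sa B"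
  using star_mult by (simp add: sa_def m_comm)

lemma minus_one_mult: "x \<in> carrier B \<Longrightarrow> scal (- 1) \<otimes> x = \<ominus> x"
  by (simp add: scal_minus scal_1 l_minus)

lemma uminus_sa [simp, intro]: "a \<in> sa B \<Longrightarrow> \<ominus> a \<in> sa B"
  using mult_sa[of "scal (- 1)" a] minus_one_mult[of a] by (simp add: sa_closed)

lemma minus_sa [simp, intro]: "\<lbrakk>a \<in> sa B; b \<in> sa B\<rbrakk> \<Longrightarrow> a \<ominus> b \<in> sa B"
  by (simp add: minus_eq)

section \<open>Norm estimates\<close>

lemma nrm_uminus: "x \<in> carrier B \<Longrightarrow> nrm B (\<ominus> x) = nrm B x"
  using minus_one_mult[of x] scal_smult[of x "- 1"] nrm_smult[of x "- 1"] by simp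

lemma nrm_zero: "nrm B \<zero> = 0"
  using nrm_eq_0 by simp

text \<open>The C*-identity for \<open>star B x\<close> bounds the square of its norm by the product
  of the norms of \<open>x\<close> and \<open>star B x\<close>; cancel one factor. The involution is
  thus continuous, which will show that limits of self-adjoint elements are self-adjoint.\<close>

lemma nrm_star_le:
  assumes "x \<in> carrier B"
  shows "nrm B (star B x) \<le> nrm B x"
proof -
  have "(nrm B (star B x))\<^sup>2 \<le> nrm B x * nrm B (star B x)"
    using cstar_identity[of "star B x"] nrm_mult[of x "star B x"] star_closed star_star assms by simp
  then show ?thesis
    using nrm_nonneg[of x] nrm_nonneg[of "star B x"] star_closed[OF assms] assms
    by (cases "nrm B (star B x) = 0") (auto simp: power2_eq_square)
qed

lemma star_minus: "\<lbrakk>x \<in> carrier B; y \<in> carrier B\<rbrakk> \<Longrightarrow> star B (x \<ominus> y) = star B x \<ominus> star B y"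
proof -
  assume xy: "x \<in> carrier B" "y \<in> carrier B"
  have "star B (\<ominus> y) = \<ominus> star B y"
    using star_mult[of "scal (- 1)" y] minus_one_mult[of y] minus_one_mult[of "star B y"]
      scal_sa[of "- 1"] star_closed xy by (simp add: sa_def m_comm)
  then show ?thesis using star_add[of x "\<ominus> y"] xy by (simp add: minus_eq)
qed

lemma nrm_minus_triangle:
  assumes "u \<in> carrier B" "v \<in> carrier B" "w \<in> carrier B"
  shows "nrm B (u \<ominus> v) \<le> nrm B (u \<ominus> w) + nrm B (w \<ominus> v)"
proof -
  have "u \<ominus> v = (u \<ominus> w) \<oplus> (w \<ominus> v)" using assms by algebra
  then show ?thesis using nrm_triangle[of "u \<ominus> w" "w \<ominus> v"] assms by simp
qed

lemma nrm_minus_commute: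
  assumes "u \<in> carrier B" "v \<in> carrier B"
  shows "nrm B (u \<ominus> v) = nrm B (v \<ominus> u)"
proof -
  have "u \<ominus> v = \<ominus> (v \<ominus> u)" using assms by algebra
  then show ?thesis using nrm_uminus[of "v \<ominus> u"] assms by simp
qed

text \<open>The binomial series is avoided: \<open>1 - y\<close> is a square root of \<open>1 - x\<close> iff \<open>y\<close> is a fixed
  point of \<open>y \<mapsto> (x + y\<^sup>2) / 2\<close>, which is a contraction of the ball of radius \<open>1/2\<close>.\<close>

lemma sqrt_one_minus:
  assumes x: "x \<in> sa B" and xn: "nrm B x \<le> 1/2"
  shows "\<exists>c\<in>sa B. \<one> \<ominus> x = c \<otimes> c"
proof -
  have xc: "x \<in> carrier B" using x by (rule sa_closed)
  define \<phi> where "\<phi> y = scal (1/2) \<otimes> (x \<oplus> y \<otimes> y)" for y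
  define Y where "Y n = (\<phi> ^^ n) \<zero>" for n
  have Y0: "Y 0 = \<zero>" and YS: "\<And>n. Y (Suc n) = \<phi> (Y n)" by (simp_all add: Y_def)
  have \<phi>c: "y \<in> carrier B \<Longrightarrow> \<phi> y \<in> carrier B" for y using xc by (simp add: \<phi>_def)
  have Ysa: "Y n \<in> sa B" for n
    by (induction n) (use x in \<open>simp_all add: Y0 YS \<phi>_def\<close>)
  then have Yc: "Y n \<in> carrier B" for n by blast
  have half: "nrm B (scal (1/2) \<otimes> z) = nrm B z / 2" if "z \<in> carrier B" for z
    using that nrm_smult[of z "complex_of_real (1/2)"] by (simp add: scal_smult)
  have Yn: "nrm B (Y n) \<le> 1/2" for n
  proof (induction n)
    case 0 then show ?case by (simp add: Y0 nrm_zero)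
  next
    case (Suc n)
    have "nrm B (Y n \<otimes> Y n) \<le> nrm B (Y n) * nrm B (Y n)" by (rule nrm_mult[OF Yc Yc])
    also have "\<dots> \<le> 1/2 * (1/2)" using Suc nrm_nonneg[OF Yc] by (intro mult_mono) auto
    finally have "nrm B (x \<oplus> Y n \<otimes> Y n) \<le> 1"
      using nrm_triangle[of x "Y n \<otimes> Y n"] xn xc Yc by simp
    then show ?case using half[of "x \<oplus> Y n \<otimes> Y n"] xc Yc by (simp add: YS \<phi>_def)
  qed
  \<comment> \<open>The difference of the squares factors as \<open>(y - z) (y + z)\<close>, so on
    the ball of radius 1/2 the map contracts by 1/2.\<close>
  have lip: "nrm B (\<phi> y \<ominus> \<phi> z) \<le> nrm B (y \<ominus> z) * (nrm B y + nrm B z) / 2"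
    if y: "y \<in> carrier B" and z: "z \<in> carrier B" for y z
  proof -
    have "\<phi> y \<ominus> \<phi> z = scal (1/2) \<otimes> ((y \<ominus> z) \<otimes> (y \<oplus> z))"
      unfolding \<phi>_def using y z xc scal_closed[of "1/2"] by algebra
    then have "nrm B (\<phi> y \<ominus> \<phi> z) = nrm B ((y \<ominus> z) \<otimes> (y \<oplus> z)) / 2"
      using half y z by simp
    also have "\<dots> \<le> nrm B (y \<ominus> z) * nrm B (y \<oplus> z) / 2"
      using nrm_mult[of "y \<ominus> z" "y \<oplus> z"] y z by simp
    also have "\<dots> \<le> nrm B (y \<ominus> z) * (nrm B y + nrm B z) / 2"
      using nrm_triangle[OF y z] nrm_nonneg[of "y \<ominus> z"] y z by (simp add: mult_left_mono)
    finally show ?thesis .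
  qed
  \<comment> \<open>The induction starts from the crude bound 1 on the distance of any iterate to
    zero; the estimate is uniform in \<open>k\<close>, so it yields the Cauchy property
    directly.\<close>
  have contr: "nrm B (Y (n + k) \<ominus> Y n) \<le> (1/2) ^ n" for n k
  proof (induction n)
    case 0
    then show ?case using Yn[of k] Yc[of k] by (simp add: Y0 minus_eq)
  next
    case (Suc n)
    have "nrm B (Y (Suc n + k) \<ominus> Y (Suc n)) \<le> nrm B (Y (n + k) \<ominus> Y n) * (nrm B (Y (n + k)) + nrm B (Y n)) / 2"
      using lip[OF Yc Yc] by (simp add: YS)
    also have "\<dots> \<le> (1/2) ^ n * 1 / 2"
      using Suc Yn[of "n + k"] Yn[of n] nrm_nonneg[OF Yc] nrm_nonneg[of "Y (n + k) \<ominus> Y n"] Yc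
      by (intro divide_right_mono mult_mono) auto
    finally show ?case by simp
  qed
  have "\<exists>y\<in>carrier B. (\<lambda>n. nrm B (Y n \<ominus> y)) \<longlonglongrightarrow> 0"
  proof (rule complete[OF Yc])
    fix e :: real assume "0 < e"
    then obtain N where N: "(1/2::real) ^ N < e / 2"
      using real_arch_pow_inv[of "e/2" "1/2"] by auto
    have "nrm B (Y m \<ominus> Y n) < e" if "N \<le> m" "N \<le> n" for m n
    proof -
      have "nrm B (Y k \<ominus> Y N) < e / 2" if "N \<le> k" for k
        using contr[of N "k - N"] N that by simp
      note this[OF \<open>N \<le> m\<close>] this[OF \<open>N \<le> n\<close>]
      moreover have "nrm B (Y m \<ominus> Y n) \<le> nrm B (Y m \<ominus> Y N) + nrm B (Y n \<ominus> Y N)"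
        using nrm_minus_triangle[of "Y m" "Y n" "Y N"] nrm_minus_commute[of "Y N" "Y n"] Yc by simp
      ultimately show ?thesis by simp
    qed
    then show "\<exists>N. \<forall>m\<ge>N. \<forall>n\<ge>N. nrm B (Y m \<ominus> Y n) < e" by blast
  qed
  then obtain y where yc: "y \<in> carrier B" and lim: "(\<lambda>n. nrm B (Y n \<ominus> y)) \<longlonglongrightarrow> 0" by blast
  \<comment> \<open>Used to pass to the limit: the errors of two consecutive iterates occur because
    \<open>\<phi>\<close> moves \<open>Y n\<close> to \<open>Y (Suc n)\<close>.\<close>
  have eqI: "u = v" if uv: "u \<in> carrier B" "v \<in> carrier B"
    and le: "\<And>n. nrm B (u \<ominus> v) \<le> K * nrm B (Y n \<ominus> y) + K * nrm B (Y (Suc n) \<ominus> y)" for u v K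
  proof -
    have "(\<lambda>n. K * nrm B (Y n \<ominus> y) + K * nrm B (Y (Suc n) \<ominus> y)) \<longlonglongrightarrow> K * 0 + K * 0"
      using lim LIMSEQ_Suc[OF lim] by (intro tendsto_intros)
    then have "nrm B (u \<ominus> v) \<le> 0" using le by (intro LIMSEQ_le_const) auto
    then have "u \<ominus> v = \<zero>" using nrm_nonneg[of "u \<ominus> v"] nrm_eq_0[of "u \<ominus> v"] uv by simp
    moreover have "u = (u \<ominus> v) \<oplus> v" using uv by algebra
    ultimately show ?thesis using uv by simp
  qed
  \<comment> \<open>The involution fixes every iterate and does not increase distances, so
    \<open>star B y\<close> is a limit of the iterates as well.\<close>
  have "star B y = y"
  proof (rule eqI[where K = 2, OF star_closed[OF yc] yc])
    fix n
    have "nrm B (star B y \<ominus> Y (Suc n)) \<le> nrm B (y \<ominus> Y (Suc n))"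
      using nrm_star_le[of "y \<ominus> Y (Suc n)"] star_minus[OF yc Yc[of "Suc n"]] Ysa[of "Suc n"] yc Yc[of "Suc n"]
      by (simp add: sa_def)
    then have "nrm B (star B y \<ominus> y) \<le> 2 * nrm B (Y (Suc n) \<ominus> y)"
      using nrm_minus_triangle[OF star_closed[OF yc] yc Yc[of "Suc n"]]
        nrm_minus_commute[OF yc Yc[of "Suc n"]] by simp
    then show "nrm B (star B y \<ominus> y) \<le> 2 * nrm B (Y n \<ominus> y) + 2 * nrm B (Y (Suc n) \<ominus> y)"
      using nrm_nonneg[of "Y n \<ominus> y"] Yc yc by simp
  qed
  then have ysa: "y \<in> sa B" using yc by (simp add: sa_def)
  \<comment> \<open>The constant \<open>nrm B y + 1\<close> dominates the Lipschitz factor between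
    \<open>y\<close> and any iterate, without a proof that the limit stays in the ball.\<close>
  have "\<phi> y = y"
  proof (rule eqI[where K = "nrm B y + 1", OF \<phi>c[OF yc] yc])
    fix n
    have "nrm B (y \<ominus> Y n) * (nrm B y + nrm B (Y n)) / 2 \<le> nrm B (y \<ominus> Y n) * (nrm B y + 1)"
      using mult_left_mono[of "(nrm B y + nrm B (Y n)) / 2" "nrm B y + 1" "nrm B (y \<ominus> Y n)"]
        Yn[of n] nrm_nonneg[OF yc] nrm_nonneg[of "y \<ominus> Y n"] yc Yc by simp
    then have "nrm B (\<phi> y \<ominus> Y (Suc n)) \<le> (nrm B y + 1) * nrm B (Y n \<ominus> y)"
      using lip[OF yc Yc[of n]] nrm_minus_commute[OF yc Yc[of n]] by (simp add: YS mult.commute)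
    moreover have "nrm B (Y (Suc n) \<ominus> y) \<le> (nrm B y + 1) * nrm B (Y (Suc n) \<ominus> y)"
      using nrm_nonneg[of "Y (Suc n) \<ominus> y"] nrm_nonneg[OF yc] Yc yc by (simp add: algebra_simps)
    ultimately show "nrm B (\<phi> y \<ominus> y) \<le> (nrm B y + 1) * nrm B (Y n \<ominus> y) + (nrm B y + 1) * nrm B (Y (Suc n) \<ominus> y)"
      using nrm_minus_triangle[OF \<phi>c[OF yc] yc Yc[of "Suc n"]] by simp
  qed
  moreover have "\<phi> y \<oplus> \<phi> y = x \<oplus> y \<otimes> y"
  proof -
    have "\<phi> y \<oplus> \<phi> y = (scal (1/2) \<oplus> scal (1/2)) \<otimes> (x \<oplus> y \<otimes> y)"
      unfolding \<phi>_def using scal_closed[of "1/2"] xc yc by algebra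
    moreover have "scal (1/2) \<oplus> scal (1/2) = \<one>"
      using scal_add[of "1/2" "1/2"] scal_1 by simp
    ultimately show ?thesis using xc yc by simp
  qed
  ultimately have xy: "y \<oplus> y = x \<oplus> y \<otimes> y" by simp
  have "(\<one> \<ominus> y) \<otimes> (\<one> \<ominus> y) = \<one> \<ominus> (y \<oplus> y) \<oplus> y \<otimes> y"
    using yc by algebra
  also have "\<dots> = \<one> \<ominus> x" unfolding xy using yc xc by algebra
  finally show ?thesis using ysa by (metis minus_sa one_sa)
qed

text \<open>After division by \<open>N\<close> the element has norm at most 1/2, which is where the
  factor 2 comes from. If \<open>c\<close> is a square root of \<open>1 - a / N\<close>, then
  \<open>N - a\<close> is the square of \<open>sqrt N * c\<close>.\<close>

lemma sa_le_scal:
  assumes a: "a \<in> sa B" and N: "0 < N" "2 * nrm B a \<le> N"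
  shows "sa_le B (a \<ominus> scal N) \<zero>"
proof -
  have ac: "a \<in> carrier B" using a by blast
  have "nrm B (scal (1/N) \<otimes> a) \<le> 1/2"
  proof -
    have "nrm B (scal (1/N) \<otimes> a) = nrm B a / N"
      using N nrm_smult[OF ac, of "complex_of_real (1/N)"] ac by (simp add: scal_smult norm_divide)
    also have "\<dots> \<le> 1/2" using N by (simp add: field_simps)
    finally show ?thesis .
  qed
  then obtain c where c: "c \<in> sa B" "\<one> \<ominus> scal (1/N) \<otimes> a = c \<otimes> c"
    using sqrt_one_minus[of "scal (1/N) \<otimes> a"] a by auto
  have "\<zero> \<ominus> (a \<ominus> scal N) = scal N \<ominus> a"
    using ac scal_closed[of N] by algebra
  also have "\<dots> = scal N \<ominus> scal (N * (1/N)) \<otimes> a"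
    using N ac by (simp add: scal_1)
  also have "\<dots> = scal N \<otimes> (\<one> \<ominus> scal (1/N) \<otimes> a)"
    unfolding scal_mult using ac scal_closed[of N] scal_closed[of "1/N"] by algebra
  also have "\<dots> = (scal (sqrt N) \<otimes> scal (sqrt N)) \<otimes> (c \<otimes> c)"
    using N scal_mult[of "sqrt N" "sqrt N"] c by simp
  also have "\<dots> = (scal (sqrt N) \<otimes> c) \<otimes> (scal (sqrt N) \<otimes> c)"
    using scal_closed[of "sqrt N"] sa_closed[OF c(1)] by algebra
  finally show ?thesis unfolding sa_le_def using c(1) by blast
qed

lemma sa_le_scal_nonpos:
  assumes "r \<le> 0"
  shows "sa_le B (scal r) \<zero>"
proof -
  have "\<zero> \<ominus> scal r = scal (sqrt (- r)) \<otimes> scal (sqrt (- r))"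
    using scal_diff[of 0 r] scal_0 scal_mult[of "sqrt (- r)" "sqrt (- r)"] assms by simp
  then show ?thesis unfolding sa_le_def by blast
qed

text \<open>Absorbs a small multiple of \<open>a\<close> into the error \<open>e\<close>. The number
  \<open>d\<close> may have either sign, and both signs are used for products.\<close>

lemma sa_le_scal_mult:
  assumes a: "a \<in> sa B" and "0 < e" and "2 * (\<bar>d\<bar> * nrm B a) \<le> e"
  shows "sa_le B (scal d \<otimes> a \<ominus> scal e) \<zero>"
proof (rule sa_le_scal)
  show "2 * nrm B (scal d \<otimes> a) \<le> e"
    using assms nrm_smult[OF sa_closed[OF a], of "complex_of_real d"] by (simp add: scal_smult sa_closed)
qed (use assms in auto)

end

section \<open>Interpolation in the Gelfand lattice\<close>

context unital_comm_cstar
begin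

lemma lterms_simps [simp]:
  "D a \<in> lterms B \<longleftrightarrow> a \<in> sa B" "LTop \<in> lterms B" "LBot \<in> lterms B"
  "LMeet s t \<in> lterms B \<longleftrightarrow> s \<in> lterms B \<and> t \<in> lterms B"
  "LJoin s t \<in> lterms B \<longleftrightarrow> s \<in> lterms B \<and> t \<in> lterms B"
  by (auto simp: lterms_def)

lemma lterm_le_closed: "lterm_le B s t \<Longrightarrow> s \<in> lterms B \<and> t \<in> lterms B"
  by (induction rule: lterm_le.induct) auto

lemma lterm_le_meet_mono:
  assumes s: "lterm_le B s s'" and t: "lterm_le B t t'"
  shows "lterm_le B (LMeet s t) (LMeet s' t')"
proof -
  have c: "s \<in> lterms B" "t \<in> lterms B" using lterm_le_closed[OF s] lterm_le_closed[OF t] by auto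
  show ?thesis
    by (rule lterm_le.meetI[OF lterm_le.trans[OF lterm_le.meet1[OF c] s] lterm_le.trans[OF lterm_le.meet2[OF c] t]])
qed

lemma lterm_le_join_mono:
  assumes s: "lterm_le B s s'" and t: "lterm_le B t t'"
  shows "lterm_le B (LJoin s t) (LJoin s' t')"
proof -
  have c: "s' \<in> lterms B" "t' \<in> lterms B" using lterm_le_closed[OF s] lterm_le_closed[OF t] by auto
  show ?thesis
    by (rule lterm_le.joinE[OF lterm_le.trans[OF s lterm_le.join1[OF c]] lterm_le.trans[OF t lterm_le.join2[OF c]]])
qed

lemma lterm_le_joinI1: "\<lbrakk>lterm_le B q s; t \<in> lterms B\<rbrakk> \<Longrightarrow> lterm_le B q (LJoin s t)"
  using lterm_le.trans[OF _ lterm_le.join1] lterm_le_closed by blast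

lemma lterm_le_joinI2: "\<lbrakk>lterm_le B q t; s \<in> lterms B\<rbrakk> \<Longrightarrow> lterm_le B q (LJoin s t)"
  using lterm_le.trans[OF _ lterm_le.join2] lterm_le_closed by blast

lemma lterm_le_meetD1: "lterm_le B q (LMeet s t) \<Longrightarrow> lterm_le B q s"
  using lterm_le.trans[OF _ lterm_le.meet1] lterm_le_closed by fastforce

lemma lterm_le_meetD2: "lterm_le B q (LMeet s t) \<Longrightarrow> lterm_le B q t"
  using lterm_le.trans[OF _ lterm_le.meet2] lterm_le_closed by fastforce

lemma lterm_le_botE: "\<lbrakk>lterm_le B q LBot; t \<in> lterms B\<rbrakk> \<Longrightarrow> lterm_le B q t"
  by (rule lterm_le.trans[OF _ lterm_le.bot])

text \<open>Distributivity as disjunction elimination, with \<open>q\<close> in the role of the context.\<close>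

lemma lterm_le_join_cases:
  assumes q: "lterm_le B q (LJoin s t)"
    and s: "\<And>p. \<lbrakk>lterm_le B p q; lterm_le B p s\<rbrakk> \<Longrightarrow> lterm_le B p r"
    and t: "\<And>p. \<lbrakk>lterm_le B p q; lterm_le B p t\<rbrakk> \<Longrightarrow> lterm_le B p r"
  shows "lterm_le B q r"
proof -
  have c: "q \<in> lterms B" "s \<in> lterms B" "t \<in> lterms B" using lterm_le_closed[OF q] by auto
  have "lterm_le B q (LMeet q (LJoin s t))" using q c by (simp add: lterm_le.refl lterm_le.meetI)
  moreover have "lterm_le B (LMeet q (LJoin s t)) (LJoin (LMeet q s) (LMeet q t))"
    using c by (rule lterm_le.distrib)
  moreover have "lterm_le B (LJoin (LMeet q s) (LMeet q t)) r"
    using s[of "LMeet q s"] t[of "LMeet q t"] c by (simp add: lterm_le.joinE lterm_le.meet1 lterm_le.meet2)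
  ultimately show ?thesis by (rule lterm_le.trans[OF lterm_le.trans])
qed

section \<open>Derived rules for the generators\<close>

lemma D_absurd:
  assumes "lterm_le B q (D a)" "lterm_le B q (D (\<ominus> a))" "t \<in> lterms B"
  shows "lterm_le B q t"
proof -
  have "a \<in> sa B" using lterm_le_closed[OF assms(1)] by simp
  then have "lterm_le B q LBot"
    by (rule lterm_le.trans[OF lterm_le.meetI[OF assms(1,2)] lterm_le.D_disjoint])
  then show ?thesis using assms(3) by (rule lterm_le_botE)
qed

lemma D_addD: "\<lbrakk>lterm_le B q (D c); c = a \<oplus> b; a \<in> sa B; b \<in> sa B\<rbrakk> \<Longrightarrow> lterm_le B q (LJoin (D a) (D b))"
  using lterm_le.trans[OF _ lterm_le.D_add] by simp

text \<open>Write \<open>a\<close> as \<open>b + (a - b)\<close> and use subadditivity; the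
  generator of the nonpositive summand is bottom.\<close>

lemma D_mono:
  assumes q: "lterm_le B q (D a)" and b: "b \<in> sa B" and le: "sa_le B (a \<ominus> b) \<zero>"
  shows "lterm_le B q (D b)"
proof -
  have a: "a \<in> sa B" using lterm_le_closed[OF q] by simp
  have "a = b \<oplus> (a \<ominus> b)" using a b sa_closed by algebra
  then have "lterm_le B q (LJoin (D b) (D (a \<ominus> b)))"
    using D_addD[OF q] a b by simp
  moreover have "lterm_le B (D (a \<ominus> b)) LBot"
    using lterm_le.D_nonpos[OF _ le] a b by simp
  then have "lterm_le B (LJoin (D b) (D (a \<ominus> b))) (D b)"
    using lterm_le_botE b lterm_le.refl[of "D b" B] by (simp add: lterm_le.joinE)
  ultimately show ?thesis by (rule lterm_le.trans)
qed

text \<open>Since \<open>a = (a + b) - b\<close>, subadditivity leaves two cases: the desired one,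
  and \<open>D (\<ominus> b)\<close>, which contradicts \<open>D b\<close>.\<close>

lemma D_addI:
  assumes a: "lterm_le B q (D a)" and b: "lterm_le B q (D b)"
  shows "lterm_le B q (D (a \<oplus> b))"
proof -
  have ab: "a \<in> sa B" "b \<in> sa B" using a b lterm_le_closed by fastforce+
  have "a = (a \<oplus> b) \<oplus> \<ominus> b" using ab sa_closed by algebra
  then have "lterm_le B q (LJoin (D (a \<oplus> b)) (D (\<ominus> b)))"
    using D_addD[OF a] ab by simp
  then show ?thesis
  proof (rule lterm_le_join_cases)
    fix p assume "lterm_le B p q" "lterm_le B p (D (\<ominus> b))"
    then show "lterm_le B p (D (a \<oplus> b))"
      using D_absurd[OF lterm_le.trans[OF _ b], of p] ab by simp
  qed
qed

lemma D_multI: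
  assumes a: "lterm_le B q (D a)" and b: "lterm_le B q (D b)"
  shows "lterm_le B q (D (a \<otimes> b))"
proof -
  have ab: "a \<in> sa B" "b \<in> sa B" using a b lterm_le_closed by fastforce+
  then have "lterm_le B q (LJoin (LMeet (D a) (D b)) (LMeet (D (\<ominus> a)) (D (\<ominus> b))))"
    by (intro lterm_le_joinI1 lterm_le.meetI a b) simp
  then show ?thesis by (rule lterm_le.trans[OF _ lterm_le.D_mult2[OF ab]])
qed

text \<open>Turns the product relation into a case distinction on the common sign of the two
  factors.\<close>

lemma D_mult_cases:
  assumes q: "lterm_le B q (D (a \<otimes> b))" and ab: "a \<in> sa B" "b \<in> sa B"
    and pos: "\<And>p. \<lbrakk>lterm_le B p q; lterm_le B p (D a); lterm_le B p (D b)\<rbrakk> \<Longrightarrow> lterm_le B p r"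
    and neg: "\<And>p. \<lbrakk>lterm_le B p q; lterm_le B p (D (\<ominus> a)); lterm_le B p (D (\<ominus> b))\<rbrakk> \<Longrightarrow> lterm_le B p r"
  shows "lterm_le B q r"
proof (rule lterm_le_join_cases)
  show "lterm_le B q (LJoin (LMeet (D a) (D b)) (LMeet (D (\<ominus> a)) (D (\<ominus> b))))"
    by (rule lterm_le.trans[OF q lterm_le.D_mult1[OF ab]])
qed (use pos neg lterm_le_meetD1 lterm_le_meetD2 in blast)+

text \<open>The product of \<open>r\<close> and \<open>1/r\<close> is 1, whose generator is top, so
  both factors have the same sign. It is not the negative one, because \<open>- r\<close> is
  nonpositive.\<close>

lemma D_scal_pos:
  assumes r: "0 < r" and t: "t \<in> lterms B"
  shows "lterm_le B t (D (scal r))"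
proof -
  have "lterm_le B LTop (D (scal r \<otimes> scal (1/r)))"
    using lterm_le.D_one[of B] r scal_mult[of r "1/r"] by (simp add: scal_1)
  then have "lterm_le B LTop (D (scal r))"
  proof (rule D_mult_cases)
    fix p assume "lterm_le B p LTop" "lterm_le B p (D (\<ominus> scal r))"
    moreover have "lterm_le B (D (\<ominus> scal r)) LBot"
      using lterm_le.D_nonpos[of "scal (- r)"] sa_le_scal_nonpos[of "- r"] r by (simp add: scal_minus)
    ultimately show "lterm_le B p (D (scal r))"
      using lterm_le_botE[OF lterm_le.trans] by simp
  qed auto
  then show ?thesis by (rule lterm_le.trans[OF lterm_le.top[OF t]])
qed

section \<open>Shifting the generators by a real number\<close>

definition shift :: "real \<Rightarrow> 'a lterm \<Rightarrow> 'a lterm" where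
  "shift r = map_lterm (\<lambda>a. a \<ominus> scal r)"

lemma shift_simps [simp]:
  "shift r (D a) = D (a \<ominus> scal r)" "shift r LTop = LTop" "shift r LBot = LBot"
  "shift r (LMeet s t) = LMeet (shift r s) (shift r t)"
  "shift r (LJoin s t) = LJoin (shift r s) (shift r t)"
  by (simp_all add: shift_def)

lemma shift_closed [simp, intro]: "t \<in> lterms B \<Longrightarrow> shift r t \<in> lterms B"
  by (induction t) auto

lemma shift_0: "t \<in> lterms B \<Longrightarrow> shift 0 t = t"
  by (induction t) (auto simp: scal_0 sa_closed minus_eq)

lemma D_shift_mono:
  assumes "lterm_le B q (D (a \<ominus> scal r))" "a \<in> sa B" "s \<le> r"
  shows "lterm_le B q (D (a \<ominus> scal s))"
proof (rule D_mono[OF assms(1)])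
  have "(a \<ominus> scal r) \<ominus> (a \<ominus> scal s) = scal s \<ominus> scal r"
    using sa_closed[OF assms(2)] scal_closed[of r] scal_closed[of s] by algebra
  then show "sa_le B ((a \<ominus> scal r) \<ominus> (a \<ominus> scal s)) \<zero>"
    using sa_le_scal_nonpos[of "s - r"] assms(3) by (simp add: scal_diff)
qed (use assms(2) in auto)

lemma shift_antimono: "\<lbrakk>t \<in> lterms B; s \<le> r\<rbrakk> \<Longrightarrow> lterm_le B (shift r t) (shift s t)"
proof (induction t)
  case (D a)
  then show ?case using D_shift_mono[OF lterm_le.refl] by simp
qed (auto intro: lterm_le.refl lterm_le_meet_mono lterm_le_join_mono)

lemma shift_le: "\<lbrakk>t \<in> lterms B; 0 \<le> r\<rbrakk> \<Longrightarrow> lterm_le B (shift r t) t"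
  using shift_antimono[of t 0 r] by (simp add: shift_0)

lemma D_shift_le: "\<lbrakk>a \<in> sa B; 0 \<le> r\<rbrakk> \<Longrightarrow> lterm_le B (D (a \<ominus> scal r)) (D a)"
  using shift_le[of "D a" r] by simp

text \<open>Pointwise, \<open>e < a b\<close> bounds \<open>\<bar>a\<bar>\<close> and \<open>\<bar>b\<bar>\<close> away from zero, because \<open>a\<close> and \<open>b\<close> are bounded:
  \<open>a b - e \<le> (a \<plusminus> d) b\<close> as soon as \<open>d * \<bar>b\<bar> \<le> e\<close>.\<close>

lemma D_mult1_shift:
  assumes a: "a \<in> sa B" and b: "b \<in> sa B" and e: "0 < e"
  shows "\<exists>d>0. lterm_le B (D (a \<otimes> b \<ominus> scal e))
    (LJoin (LMeet (D (a \<ominus> scal d)) (D (b \<ominus> scal d))) (LMeet (D (\<ominus> a \<ominus> scal d)) (D (\<ominus> b \<ominus> scal d))))"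
proof -
  \<comment> \<open>The denominator dominates twice either norm, and the summand 1 keeps it
    positive.\<close>
  define d where "d = e / (2 * (nrm B a + nrm B b + 1))"
  have na: "0 \<le> nrm B a" "0 \<le> nrm B b" using nrm_nonneg a b by auto
  then have d: "0 < d" using e by (simp add: d_def)
  have "2 * (d * nrm B a) \<le> e" "2 * (d * nrm B b) \<le> e"
    using na e by (simp_all add: d_def field_simps)
  then have le: "2 * (\<bar>d\<bar> * nrm B a) \<le> e" "2 * (\<bar>d\<bar> * nrm B b) \<le> e"
    "2 * (\<bar>- d\<bar> * nrm B a) \<le> e" "2 * (\<bar>- d\<bar> * nrm B b) \<le> e" using d by simp_all
  note nonpos = sa_le_scal_mult[OF a e le(1)] sa_le_scal_mult[OF b e le(2)]
    sa_le_scal_mult[OF a e le(3)] sa_le_scal_mult[OF b e le(4)]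
  note c = sa_closed[OF a] sa_closed[OF b] scal_closed[of d] scal_closed[of e]
  let ?q = "D (a \<otimes> b \<ominus> scal e)"
  let ?t = "LJoin (LMeet (D (a \<ominus> scal d)) (D (b \<ominus> scal d))) (LMeet (D (\<ominus> a \<ominus> scal d)) (D (\<ominus> b \<ominus> scal d)))"
  have t: "?t \<in> lterms B" using a b by simp
  have q: "lterm_le B ?q ?q" using a b by (simp add: lterm_le.refl)
  \<comment> \<open>Replacing one factor by its shift in either direction costs at most
    \<open>e\<close>, which gives four products implied by \<open>?q\<close>.\<close>
  have ab1: "lterm_le B ?q (D ((a \<ominus> scal d) \<otimes> b))"
  proof (rule D_mono[OF q])
    have "(a \<otimes> b \<ominus> scal e) \<ominus> (a \<ominus> scal d) \<otimes> b = scal d \<otimes> b \<ominus> scal e" using c by algebra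
    then show "sa_le B ((a \<otimes> b \<ominus> scal e) \<ominus> (a \<ominus> scal d) \<otimes> b) \<zero>" using nonpos by simp
  qed (use a b in auto)
  have ab2: "lterm_le B ?q (D ((a \<oplus> scal d) \<otimes> b))"
  proof (rule D_mono[OF q])
    have "(a \<otimes> b \<ominus> scal e) \<ominus> (a \<oplus> scal d) \<otimes> b = \<ominus> scal d \<otimes> b \<ominus> scal e" using c by algebra
    then show "sa_le B ((a \<otimes> b \<ominus> scal e) \<ominus> (a \<oplus> scal d) \<otimes> b) \<zero>" using nonpos by (simp add: scal_minus)
  qed (use a b in auto)
  have ab3: "lterm_le B ?q (D (a \<otimes> (b \<ominus> scal d)))"
  proof (rule D_mono[OF q])
    have "(a \<otimes> b \<ominus> scal e) \<ominus> a \<otimes> (b \<ominus> scal d) = scal d \<otimes> a \<ominus> scal e" using c by algebra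
    then show "sa_le B ((a \<otimes> b \<ominus> scal e) \<ominus> a \<otimes> (b \<ominus> scal d)) \<zero>" using nonpos by simp
  qed (use a b in auto)
  have ab4: "lterm_le B ?q (D (a \<otimes> (b \<oplus> scal d)))"
  proof (rule D_mono[OF q])
    have "(a \<otimes> b \<ominus> scal e) \<ominus> a \<otimes> (b \<oplus> scal d) = \<ominus> scal d \<otimes> a \<ominus> scal e" using c by algebra
    then show "sa_le B ((a \<otimes> b \<ominus> scal e) \<ominus> a \<otimes> (b \<oplus> scal d)) \<zero>" using nonpos by (simp add: scal_minus)
  qed (use a b in auto)
  have neg: "\<ominus> (a \<ominus> scal d) = scal d \<ominus> a" "\<ominus> (a \<oplus> scal d) = \<ominus> a \<ominus> scal d"
    "\<ominus> (b \<ominus> scal d) = scal d \<ominus> b" "\<ominus> (b \<oplus> scal d) = \<ominus> b \<ominus> scal d" "\<ominus> (\<ominus> b) = b"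
    using c by algebra+
  \<comment> \<open>\<open>ab1\<close> decides the sign. If \<open>a > d\<close> and
    \<open>b > 0\<close>, then \<open>ab3\<close> improves the latter to \<open>b > d\<close>. If
    \<open>b < 0\<close>, then \<open>ab2\<close> gives \<open>- a > d\<close> and after that
    \<open>ab4\<close> gives \<open>- b > d\<close>. The mixed signs are contradictory.\<close>
  have "lterm_le B ?q ?t"
  proof (rule D_mult_cases[OF ab1])
    fix p assume p: "lterm_le B p ?q" "lterm_le B p (D (a \<ominus> scal d))" "lterm_le B p (D b)"
    have pa: "lterm_le B p (D a)" 
      using lterm_le.trans[OF p(2) D_shift_le[OF a]] d by simp
    show "lterm_le B p ?t"
    proof (rule D_mult_cases[OF lterm_le.trans[OF p(1) ab3]])
      fix p' assume p': "lterm_le B p' p" "lterm_le B p' (D (b \<ominus> scal d))"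
      then show "lterm_le B p' ?t"
        using lterm_le.trans[OF p'(1) p(2)] a b by (simp add: lterm_le_joinI1 lterm_le.meetI)
    next
      fix p' assume p': "lterm_le B p' p" "lterm_le B p' (D (\<ominus> a))"
      then show "lterm_le B p' ?t" using D_absurd[OF lterm_le.trans[OF p'(1) pa] p'(2) t] by simp
    qed (use a b in auto)
  next
    fix p assume p: "lterm_le B p ?q" "lterm_le B p (D (\<ominus> b))"
    show "lterm_le B p ?t"
    proof (rule D_mult_cases[OF lterm_le.trans[OF p(1) ab2]])
      fix p' assume p': "lterm_le B p' p" "lterm_le B p' (D b)"
      show "lterm_le B p' ?t" by (rule D_absurd[OF p'(2) lterm_le.trans[OF p'(1) p(2)] t])
    next
      fix p' assume p': "lterm_le B p' p" "lterm_le B p' (D (\<ominus> (a \<oplus> scal d)))"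
      then have pa: "lterm_le B p' (D (\<ominus> a \<ominus> scal d))" by (simp add: neg)
      then have pa': "lterm_le B p' (D (\<ominus> a))"
        using lterm_le.trans[OF _ D_shift_le[of "\<ominus> a" d]] a d by simp
      show "lterm_le B p' ?t"
      proof (rule D_mult_cases[OF lterm_le.trans[OF lterm_le.trans[OF p'(1) p(1)] ab4]])
        fix p'' assume p'': "lterm_le B p'' p'" "lterm_le B p'' (D a)"
        show "lterm_le B p'' ?t" by (rule D_absurd[OF p''(2) lterm_le.trans[OF p''(1) pa'] t])
      next
        fix p'' assume p'': "lterm_le B p'' p'" "lterm_le B p'' (D (\<ominus> (b \<oplus> scal d)))"
        then show "lterm_le B p'' ?t"
          using lterm_le.trans[OF p''(1) pa] a b by (simp add: lterm_le_joinI2 lterm_le.meetI neg)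
      qed (use a b in auto)
    qed (use a b in auto)
  qed (use a b in auto)
  then show ?thesis using d by blast
qed

text \<open>With \<open>x = a - e\<close> and \<open>y = b - e\<close> one has
  \<open>a b - e^2 = x y + e x + e y\<close>, a sum of positive terms when \<open>x\<close> and
  \<open>y\<close> are positive. The other disjunct is the same identity for \<open>- a\<close> and
  \<open>- b\<close>.\<close>

lemma D_mult2_shift:
  assumes a: "a \<in> sa B" and b: "b \<in> sa B" and e: "0 < e"
  shows "lterm_le B (LJoin (LMeet (D (a \<ominus> scal e)) (D (b \<ominus> scal e)))
      (LMeet (D (\<ominus> a \<ominus> scal e)) (D (\<ominus> b \<ominus> scal e)))) (D (a \<otimes> b \<ominus> scal (e * e)))"
proof -
  note c = sa_closed[OF a] sa_closed[OF b] scal_closed[of e]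
  have step: "lterm_le B (LMeet (D x) (D y)) (D (x \<otimes> y \<oplus> scal e \<otimes> x \<oplus> scal e \<otimes> y))"
    if xy: "x \<in> sa B" "y \<in> sa B" for x y
  proof -
    have "lterm_le B (LMeet (D x) (D y)) (D x)" "lterm_le B (LMeet (D x) (D y)) (D y)"
      "lterm_le B (LMeet (D x) (D y)) (D (scal e))"
      using xy e by (simp_all add: lterm_le.meet1 lterm_le.meet2 D_scal_pos)
    then show ?thesis by (intro D_addI D_multI)
  qed
  show ?thesis
  proof (rule lterm_le.joinE)
    have "(a \<ominus> scal e) \<otimes> (b \<ominus> scal e) \<oplus> scal e \<otimes> (a \<ominus> scal e) \<oplus> scal e \<otimes> (b \<ominus> scal e) =
        a \<otimes> b \<ominus> scal (e * e)"
      unfolding scal_mult using c by algebra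
    then show "lterm_le B (LMeet (D (a \<ominus> scal e)) (D (b \<ominus> scal e))) (D (a \<otimes> b \<ominus> scal (e * e)))"
      using step[of "a \<ominus> scal e" "b \<ominus> scal e"] a b by simp
    have "(\<ominus> a \<ominus> scal e) \<otimes> (\<ominus> b \<ominus> scal e) \<oplus> scal e \<otimes> (\<ominus> a \<ominus> scal e) \<oplus> scal e \<otimes> (\<ominus> b \<ominus> scal e) =
        a \<otimes> b \<ominus> scal (e * e)"
      unfolding scal_mult using c by algebra
    then show "lterm_le B (LMeet (D (\<ominus> a \<ominus> scal e)) (D (\<ominus> b \<ominus> scal e))) (D (a \<otimes> b \<ominus> scal (e * e)))"
      using step[of "\<ominus> a \<ominus> scal e" "\<ominus> b \<ominus> scal e"] a b by simp
  qed
qed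

text \<open>A single shift need not preserve entailment: \<open>LTop\<close> entails
  \<open>D \<one>\<close>, but a shift by \<open>r \<ge> 1\<close> fixes the former and makes the
  latter bottom. Allowing a smaller shift on the right repairs this, and the order of the
  quantifiers lets the estimates compose under transitivity.\<close>

lemma shift_continuous:
  "lterm_le B s t \<Longrightarrow> \<forall>e>0. \<exists>d>0. lterm_le B (shift e s) (shift d t)"
proof (induction rule: lterm_le.induct)
  case (refl t) then show ?case by (auto intro: lterm_le.refl)
next
  case (trans r s t)
  show ?case
  proof (intro allI impI)
    fix e :: real assume "0 < e"
    then obtain d where d: "0 < d" "lterm_le B (shift e r) (shift d s)" using trans.IH(1) by blast
    then obtain c where "0 < c" "lterm_le B (shift d s) (shift c t)" using trans.IH(2) by blast
    then show "\<exists>d>0. lterm_le B (shift e r) (shift d t)" using lterm_le.trans[OF d(2)] by blast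
  qed
next
  case (top t) then show ?case by (auto intro!: exI[of _ 1] lterm_le.top)
next
  case (bot t) then show ?case by (auto intro!: exI[of _ 1] lterm_le.bot)
next
  case (meet1 s t) then show ?case by (auto intro: lterm_le.meet1)
next
  case (meet2 s t) then show ?case by (auto intro: lterm_le.meet2)
next
  case (join1 s t) then show ?case by (auto intro: lterm_le.join1)
next
  case (join2 s t) then show ?case by (auto intro: lterm_le.join2)
next
  case (meetI r s t)
  show ?case
  proof (intro allI impI)
    fix e :: real assume "0 < e"
    then obtain d d' where d: "0 < d" "lterm_le B (shift e r) (shift d s)"
      and d': "0 < d'" "lterm_le B (shift e r) (shift d' t)" using meetI.IH by blast
    have "s \<in> lterms B" "t \<in> lterms B" using meetI.hyps lterm_le_closed by auto
    \<comment> \<open>Shifts are antitone in the amount, so the smaller of the two amounts serves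
      both conjuncts.\<close>
    then have "lterm_le B (shift d s) (shift (min d d') s)" "lterm_le B (shift d' t) (shift (min d d') t)"
      by (simp_all add: shift_antimono)
    then have "lterm_le B (shift e r) (shift (min d d') (LMeet s t))"
      using lterm_le.trans[OF d(2)] lterm_le.trans[OF d'(2)] by (simp add: lterm_le.meetI)
    then show "\<exists>d>0. lterm_le B (shift e r) (shift d (LMeet s t))"
      using d d' by (intro exI[of _ "min d d'"]) auto
  qed
next
  case (joinE s r t)
  show ?case
  proof (intro allI impI)
    fix e :: real assume "0 < e"
    then obtain d d' where d: "0 < d" "lterm_le B (shift e s) (shift d r)"
      and d': "0 < d'" "lterm_le B (shift e t) (shift d' r)" using joinE.IH by blast
    have "r \<in> lterms B" using joinE.hyps lterm_le_closed by auto
    then have "lterm_le B (shift d r) (shift (min d d') r)" "lterm_le B (shift d' r) (shift (min d d') r)"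
      by (simp_all add: shift_antimono)
    then have "lterm_le B (shift e (LJoin s t)) (shift (min d d') r)"
      using lterm_le.trans[OF d(2)] lterm_le.trans[OF d'(2)] by (simp add: lterm_le.joinE)
    then show "\<exists>d>0. lterm_le B (shift e (LJoin s t)) (shift d r)"
      using d d' by (intro exI[of _ "min d d'"]) auto
  qed
next
  case (distrib r s t) then show ?case by (auto intro: lterm_le.distrib)
next
  case (D_disjoint a)
  have "lterm_le B (LMeet (D (a \<ominus> scal e)) (D (\<ominus> a \<ominus> scal e))) LBot" if "0 < e" for e
    using lterm_le.trans[OF lterm_le_meet_mono[OF D_shift_le D_shift_le] lterm_le.D_disjoint] that D_disjoint
    by simp
  then show ?case by (auto intro!: exI[of _ 1])
next
  case (D_nonpos a)
  have "lterm_le B (D (a \<ominus> scal e)) LBot" if "0 < e" for e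
    using lterm_le.trans[OF D_shift_le lterm_le.D_nonpos] that D_nonpos by simp
  then show ?case by (auto intro!: exI[of _ 1])
next
  case (D_add a b)
  show ?case
  proof (intro allI impI)
    fix e :: real assume e: "0 < e"
    \<comment> \<open>The loss is split evenly between the two summands.\<close>
    have "a \<oplus> b \<ominus> scal e = (a \<ominus> scal (e/2)) \<oplus> (b \<ominus> scal (e/2))"
    proof -
      have "scal e = scal (e/2) \<oplus> scal (e/2)" using scal_add[of "e/2" "e/2"] by simp
      then show ?thesis
        using sa_closed[OF D_add(1)] sa_closed[OF D_add(2)] scal_closed[of "e/2"]
        by (simp only:) algebra
    qed
    then show "\<exists>d>0. lterm_le B (shift e (D (a \<oplus> b))) (shift d (LJoin (D a) (D b)))"
      using e D_add lterm_le.D_add[of "a \<ominus> scal (e/2)" B "b \<ominus> scal (e/2)"]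
      by (intro exI[of _ "e/2"]) simp
  qed
next
  case D_one
  \<comment> \<open>Any \<open>d\<close> below 1 leaves a positive scalar; 1/2 is one
    choice.\<close>
  have "\<one> \<ominus> scal (1/2) = scal (1/2)" using scal_diff[of 1 "1/2"] by (simp add: scal_1)
  then show ?case using D_scal_pos[of "1/2" LTop] by (auto intro!: exI[of _ "1/2"])
next
  case (D_mult1 a b) then show ?case using D_mult1_shift[of a b] by simp
next
  case (D_mult2 a b)
  show ?case
  proof (intro allI impI)
    fix e :: real assume "0 < e"
    then show "\<exists>d>0. lterm_le B (shift e (LJoin (LMeet (D a) (D b)) (LMeet (D (\<ominus> a)) (D (\<ominus> b)))))
        (shift d (D (a \<otimes> b)))"
      using D_mult2_shift[OF D_mult2, of e] by (intro exI[of _ "e * e"]) simp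
  qed
qed

text \<open>Continuity applied to the cover of top by \<open>t\<close> and \<open>y\<close> gives a
  cover by their shifts for some \<open>r > 0\<close>. Below \<open>s\<close> the second member is
  impossible, as the shift of \<open>y\<close> lies below \<open>y\<close>.\<close>

lemma rather_below_shift:
  assumes sy: "lterm_le B (LMeet s y) LBot" and ty: "lterm_le B LTop (LJoin t y)"
  shows "\<exists>r>0. lterm_le B s (shift r t)"
proof -
  have c: "s \<in> lterms B" "t \<in> lterms B" "y \<in> lterms B"
    using lterm_le_closed[OF sy] lterm_le_closed[OF ty] by auto
  have "\<exists>r>0. lterm_le B (shift 1 LTop) (shift r (LJoin t y))"
    using shift_continuous[OF ty] zero_less_one by blast
  then obtain r where r: "0 < r" "lterm_le B LTop (LJoin (shift r t) (shift r y))" by auto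
  have "lterm_le B s (LJoin (shift r t) (shift r y))"
    using lterm_le.top[OF c(1)] r(2) by (rule lterm_le.trans)
  then have "lterm_le B s (shift r t)"
  proof (rule lterm_le_join_cases)
    fix p assume p: "lterm_le B p s" "lterm_le B p (shift r y)"
    then have "lterm_le B p y" using lterm_le.trans[OF _ shift_le[OF c(3)]] r(1) by simp
    then have "lterm_le B p LBot" by (rule lterm_le.trans[OF lterm_le.meetI[OF p(1)] sy])
    then show "lterm_le B p (shift r t)" using c by (simp add: lterm_le_botE)
  qed
  then show ?thesis using r(1) by blast
qed

text \<open>The witness is built by De Morgan duality: \<open>D a\<close> gets the generator of
  \<open>r - a\<close>, a meet gets the join of the witnesses and a join gets their meet. For a
  generator, \<open>a + (r - a) = r\<close> is positive, while \<open>r - a\<close> and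
  \<open>a - r\<close> are disjoint.\<close>

lemma shift_rather_below:
  assumes "t \<in> lterms B" and r: "0 < r"
  shows "\<exists>y\<in>lterms B. lterm_le B LTop (LJoin t y) \<and> lterm_le B (LMeet (shift r t) y) LBot"
  using assms(1)
proof (induction t)
  case (D a)
  then have a: "a \<in> sa B" by simp
  have eq: "scal r = a \<oplus> \<ominus> (a \<ominus> scal r)" using sa_closed[OF a] scal_closed[of r] by algebra
  have "lterm_le B LTop (D (scal r))" by (rule D_scal_pos[OF r]) simp
  then have "lterm_le B LTop (LJoin (D a) (D (\<ominus> (a \<ominus> scal r))))"
    by (rule D_addD[OF _ eq]) (use a in auto)
  then show ?case using lterm_le.D_disjoint[of "a \<ominus> scal r" B] a
    by (intro bexI[of _ "D (\<ominus> (a \<ominus> scal r))"]) auto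
next
  case LTop
  then show ?case by (intro bexI[of _ LBot]) (auto intro: lterm_le.join1 lterm_le.meet2)
next
  case LBot
  then show ?case by (intro bexI[of _ LTop]) (auto intro: lterm_le.join2 lterm_le.meet1)
next
  case (LMeet s t)
  then have c: "s \<in> lterms B" "t \<in> lterms B" by auto
  obtain y z where y: "y \<in> lterms B" "lterm_le B LTop (LJoin s y)" "lterm_le B (LMeet (shift r s) y) LBot"
    and z: "z \<in> lterms B" "lterm_le B LTop (LJoin t z)" "lterm_le B (LMeet (shift r t) z) LBot"
    using LMeet by auto
  have "lterm_le B LTop (LJoin (LMeet s t) (LJoin y z))"
  proof (rule lterm_le_join_cases[OF y(2)])
    fix p assume p: "lterm_le B p LTop" "lterm_le B p s"
    show "lterm_le B p (LJoin (LMeet s t) (LJoin y z))"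
    proof (rule lterm_le_join_cases[OF lterm_le.trans[OF p(1) z(2)]])
      fix p' assume p': "lterm_le B p' p" "lterm_le B p' t"
      then show "lterm_le B p' (LJoin (LMeet s t) (LJoin y z))"
        using lterm_le.trans[OF p'(1) p(2)] y(1) z(1) by (simp add: lterm_le_joinI1 lterm_le.meetI)
    qed (use c y(1) in \<open>auto intro!: lterm_le_joinI2\<close>)
  next
    fix p assume "lterm_le B p y"
    then show "lterm_le B p (LJoin (LMeet s t) (LJoin y z))"
      using c z(1) by (auto intro!: lterm_le_joinI2[of p "LJoin y z"] lterm_le_joinI1[of p y])
  qed
  moreover have "lterm_le B (LMeet (shift r (LMeet s t)) (LJoin y z)) LBot" (is "lterm_le B ?q _")
  proof -
    have q: "lterm_le B ?q ?q" using c y(1) z(1) by (auto intro: lterm_le.refl)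
    have st: "lterm_le B ?q (LMeet (shift r s) (shift r t))" using lterm_le_meetD1[OF q] by simp
    show ?thesis
    proof (rule lterm_le_join_cases[OF lterm_le_meetD2[OF q]])
      fix p assume p: "lterm_le B p ?q" "lterm_le B p y"
      have "lterm_le B p (shift r s)" by (rule lterm_le_meetD1[OF lterm_le.trans[OF p(1) st]])
      then show "lterm_le B p LBot" using y(3) p(2) by (blast intro: lterm_le.trans[OF lterm_le.meetI])
    next
      fix p assume p: "lterm_le B p ?q" "lterm_le B p z"
      have "lterm_le B p (shift r t)" by (rule lterm_le_meetD2[OF lterm_le.trans[OF p(1) st]])
      then show "lterm_le B p LBot" using z(3) p(2) by (blast intro: lterm_le.trans[OF lterm_le.meetI])
    qed
  qed
  ultimately show ?case using y(1) z(1) by (intro bexI[of _ "LJoin y z"]) auto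
next
  case (LJoin s t)
  then have c: "s \<in> lterms B" "t \<in> lterms B" by auto
  obtain y z where y: "y \<in> lterms B" "lterm_le B LTop (LJoin s y)" "lterm_le B (LMeet (shift r s) y) LBot"
    and z: "z \<in> lterms B" "lterm_le B LTop (LJoin t z)" "lterm_le B (LMeet (shift r t) z) LBot"
    using LJoin by auto
  have "lterm_le B LTop (LJoin (LJoin s t) (LMeet y z))"
  proof (rule lterm_le_join_cases[OF y(2)])
    fix p assume p: "lterm_le B p LTop" "lterm_le B p y"
    show "lterm_le B p (LJoin (LJoin s t) (LMeet y z))"
    proof (rule lterm_le_join_cases[OF lterm_le.trans[OF p(1) z(2)]])
      fix p' assume p': "lterm_le B p' p" "lterm_le B p' z"
      then show "lterm_le B p' (LJoin (LJoin s t) (LMeet y z))"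
        using lterm_le.trans[OF p'(1) p(2)] c by (simp add: lterm_le_joinI2 lterm_le.meetI)
    qed (use c y(1) z(1) in \<open>auto intro!: lterm_le_joinI1 lterm_le_joinI2[of _ t]\<close>)
  qed (use c y(1) z(1) in \<open>auto intro!: lterm_le_joinI1\<close>)
  moreover have "lterm_le B (LMeet (shift r (LJoin s t)) (LMeet y z)) LBot" (is "lterm_le B ?q _")
  proof -
    have q: "lterm_le B ?q ?q" using c y(1) z(1) by (auto intro: lterm_le.refl)
    note yz = lterm_le_meetD2[OF q]
    have "lterm_le B ?q (LJoin (shift r s) (shift r t))" using lterm_le_meetD1[OF q] by simp
    then show ?thesis
    proof (rule lterm_le_join_cases)
      fix p assume p: "lterm_le B p ?q" "lterm_le B p (shift r s)"
      have "lterm_le B p y" by (rule lterm_le_meetD1[OF lterm_le.trans[OF p(1) yz]])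
      then show "lterm_le B p LBot" using y(3) p(2) by (blast intro: lterm_le.trans[OF lterm_le.meetI])
    next
      fix p assume p: "lterm_le B p ?q" "lterm_le B p (shift r t)"
      have "lterm_le B p z" by (rule lterm_le_meetD2[OF lterm_le.trans[OF p(1) yz]])
      then show "lterm_le B p LBot" using z(3) p(2) by (blast intro: lterm_le.trans[OF lterm_le.meetI])
    qed
  qed
  ultimately show ?case using y(1) z(1) by (intro bexI[of _ "LMeet y z"]) auto
qed

end

section \<open>The quotient lattice\<close>

lemma carrier_Lat [simp]: "carrier (Lat B) = lclass B ` lterms B"
  and eq_Lat [simp]: "eq (Lat B) = (=)"
  by (simp_all add: Lat_def)

context unital_comm_cstar
begin

lemma lclass_self: "t \<in> lterms B \<Longrightarrow> t \<in> lclass B t"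
  by (simp add: lclass_def lterm_le.refl)

lemma le_Lat_iff [simp]:
  assumes s: "s \<in> lterms B" and t: "t \<in> lterms B"
  shows "lclass B s \<sqsubseteq>\<^bsub>Lat B\<^esub> lclass B t \<longleftrightarrow> lterm_le B s t"
proof
  assume "lclass B s \<sqsubseteq>\<^bsub>Lat B\<^esub> lclass B t"
  then obtain s' t' where "lterm_le B s s'" "lterm_le B s' t'" "lterm_le B t' t"
    by (auto simp: Lat_def lclass_def)
  then show "lterm_le B s t" by (rule lterm_le.trans[OF lterm_le.trans])
next
  assume "lterm_le B s t"
  then show "lclass B s \<sqsubseteq>\<^bsub>Lat B\<^esub> lclass B t"
    using lclass_self s t by (auto simp: Lat_def)
qed

lemma lclass_eqI:
  assumes st: "lterm_le B s t" and ts: "lterm_le B t s"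
  shows "lclass B s = lclass B t"
proof -
  have "lterm_le B p s \<longleftrightarrow> lterm_le B p t" "lterm_le B s p \<longleftrightarrow> lterm_le B t p" for p
    using lterm_le.trans[OF _ st, of p] lterm_le.trans[OF _ ts, of p]
      lterm_le.trans[OF st, of p] lterm_le.trans[OF ts, of p] by blast+
  then show ?thesis by (simp add: lclass_def)
qed

lemma lclass_eq_iff:
  assumes "s \<in> lterms B"
  shows "lclass B s = lclass B t \<longleftrightarrow> lterm_le B s t \<and> lterm_le B t s"
proof
  assume "lclass B s = lclass B t"
  then have "s \<in> lclass B t" using lclass_self[OF assms] by simp
  then show "lterm_le B s t \<and> lterm_le B t s" by (simp add: lclass_def)
qed (simp add: lclass_eqI)

lemma partial_order_Lat: "partial_order (Lat B)"
proof (unfold_locales, goal_cases)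
  case (4 X) then show ?case by (auto simp: lterm_le.refl)
next
  case (5 X Y)
  then obtain s t where "X = lclass B s" "s \<in> lterms B" "Y = lclass B t" "t \<in> lterms B" by auto
  with 5 show ?case using lclass_eqI[of s t] by simp
next
  case (6 X Y Z)
  then obtain r s t where "X = lclass B r" "r \<in> lterms B" "Y = lclass B s" "s \<in> lterms B"
    "Z = lclass B t" "t \<in> lterms B" by auto
  with 6 show ?case using lterm_le.trans[of B r s t] by simp
qed auto

lemma least_Lat_join:
  assumes c: "s \<in> lterms B" "t \<in> lterms B"
  shows "least (Lat B) (lclass B (LJoin s t)) (Upper (Lat B) {lclass B s, lclass B t})"
proof (rule least_UpperI)
  fix X assume "X \<in> Upper (Lat B) {lclass B s, lclass B t}"
  then have "X \<in> carrier (Lat B)" and X: "lclass B s \<sqsubseteq>\<^bsub>Lat B\<^esub> X" "lclass B t \<sqsubseteq>\<^bsub>Lat B\<^esub> X"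
    using Upper_memD[of X "Lat B" "{lclass B s, lclass B t}" "lclass B s"]
      Upper_memD[of X "Lat B" "{lclass B s, lclass B t}" "lclass B t"] c by simp_all
  then obtain r where "X = lclass B r" "r \<in> lterms B" by auto
  with X c show "lclass B (LJoin s t) \<sqsubseteq>\<^bsub>Lat B\<^esub> X"
    by (simp add: lterm_le.joinE)
qed (use c in \<open>auto simp: lterm_le.join1 lterm_le.join2\<close>)

lemma greatest_Lat_meet:
  assumes c: "s \<in> lterms B" "t \<in> lterms B"
  shows "greatest (Lat B) (lclass B (LMeet s t)) (Lower (Lat B) {lclass B s, lclass B t})"
proof (rule greatest_LowerI)
  fix X assume "X \<in> Lower (Lat B) {lclass B s, lclass B t}"
  then have "X \<in> carrier (Lat B)" and X: "X \<sqsubseteq>\<^bsub>Lat B\<^esub> lclass B s" "X \<sqsubseteq>\<^bsub>Lat B\<^esub> lclass B t"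
    using Lower_memD[of X "Lat B" "{lclass B s, lclass B t}" "lclass B s"]
      Lower_memD[of X "Lat B" "{lclass B s, lclass B t}" "lclass B t"] c by simp_all
  then obtain r where "X = lclass B r" "r \<in> lterms B" by auto
  with X c show "X \<sqsubseteq>\<^bsub>Lat B\<^esub> lclass B (LMeet s t)"
    by (simp add: lterm_le.meetI)
qed (use c in \<open>auto simp: lterm_le.meet1 lterm_le.meet2\<close>)

lemma bounded_lattice_Lat: "bounded_lattice (Lat B)"
proof -
  interpret partial_order "Lat B" by (rule partial_order_Lat)
  show ?thesis
  proof
    fix X Y assume "X \<in> carrier (Lat B)" "Y \<in> carrier (Lat B)"
    then obtain s t where "X = lclass B s" "s \<in> lterms B" "Y = lclass B t" "t \<in> lterms B" by auto
    then show "\<exists>Z. least (Lat B) Z (Upper (Lat B) {X, Y})" "\<exists>Z. greatest (Lat B) Z (Lower (Lat B) {X, Y})"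
      using least_Lat_join[of s t] greatest_Lat_meet[of s t] by blast+
  next
    have "least (Lat B) (lclass B LBot) (carrier (Lat B))"
      by (auto simp: least_def lterm_le.bot)
    then show "\<exists>b. least (Lat B) b (carrier (Lat B))" by blast
    have "greatest (Lat B) (lclass B LTop) (carrier (Lat B))"
      by (auto simp: greatest_def lterm_le.top)
    then show "\<exists>b. greatest (Lat B) b (carrier (Lat B))" by blast
  qed
qed

text \<open>The operations of an abstract order pick some least or greatest bound; uniqueness of
  bounds identifies it with the class of the corresponding term.\<close>

lemma
  assumes c: "s \<in> lterms B" "t \<in> lterms B"
  shows join_Lat [simp]: "lclass B s \<squnion>\<^bsub>Lat B\<^esub> lclass B t = lclass B (LJoin s t)"
    and meet_Lat [simp]: "lclass B s \<sqinter>\<^bsub>Lat B\<^esub> lclass B t = lclass B (LMeet s t)"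
proof -
  interpret bounded_lattice "Lat B" by (rule bounded_lattice_Lat)
  have s: "lclass B s \<in> carrier (Lat B)" and t: "lclass B t \<in> carrier (Lat B)" using c by auto
  show "lclass B s \<squnion>\<^bsub>Lat B\<^esub> lclass B t = lclass B (LJoin s t)"
    by (rule joinI[OF _ s t]) (rule least_unique[OF _ least_Lat_join[OF c]])
  show "lclass B s \<sqinter>\<^bsub>Lat B\<^esub> lclass B t = lclass B (LMeet s t)"
    by (rule meetI[OF _ s t]) (rule greatest_unique[OF _ greatest_Lat_meet[OF c]])
qed

lemma bottom_Lat [simp]: "\<bottom>\<^bsub>Lat B\<^esub> = lclass B LBot"
  and top_Lat [simp]: "\<top>\<^bsub>Lat B\<^esub> = lclass B LTop"
proof -
  interpret bounded_lattice "Lat B" by (rule bounded_lattice_Lat)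
  show "\<bottom>\<^bsub>Lat B\<^esub> = lclass B LBot" by (rule bottom_eq[symmetric]) (auto simp: lterm_le.bot)
  show "\<top>\<^bsub>Lat B\<^esub> = lclass B LTop" by (rule top_eq[symmetric]) (auto simp: lterm_le.top)
qed

lemma rather_below_Lat_iff:
  assumes c: "s \<in> lterms B" "t \<in> lterms B"
  shows "rather_below (Lat B) (lclass B s) (lclass B t) \<longleftrightarrow>
    (\<exists>y\<in>lterms B. lterm_le B LTop (LJoin t y) \<and> lterm_le B (LMeet s y) LBot)"
  using c by (auto simp: rather_below_def lclass_eq_iff lterm_le.top lterm_le.bot)

end

section \<open>Functoriality in the algebra\<close>

locale cstar_hom = A: unital_comm_cstar A + B: unital_comm_cstar B
  for A :: "'a cstar" and B :: "'b cstar" +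
  fixes g :: "'a \<Rightarrow> 'b"
  assumes hom: "g \<in> star_hom A B"
begin

lemma ring_hom: "g \<in> ring_hom A B"
  using hom by (simp add: star_hom_def)

lemma hom_closed: "x \<in> carrier A \<Longrightarrow> g x \<in> carrier B"
  by (rule ring_hom_closed[OF ring_hom])

lemma hom_sa: "a \<in> sa A \<Longrightarrow> g a \<in> sa B"
  using hom hom_closed by (auto simp: star_hom_def sa_def)

lemma hom_scal: "g (A.scal r) = B.scal r"
  using hom ring_hom_one[OF ring_hom] by (simp add: star_hom_def A.scal_def B.scal_def)

lemma hom_add: "\<lbrakk>x \<in> carrier A; y \<in> carrier A\<rbrakk> \<Longrightarrow> g (x \<oplus>\<^bsub>A\<^esub> y) = g x \<oplus>\<^bsub>B\<^esub> g y"
  by (rule ring_hom_add[OF ring_hom])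

lemma hom_mult: "\<lbrakk>x \<in> carrier A; y \<in> carrier A\<rbrakk> \<Longrightarrow> g (x \<otimes>\<^bsub>A\<^esub> y) = g x \<otimes>\<^bsub>B\<^esub> g y"
  by (rule ring_hom_mult[OF ring_hom])

lemma hom_uminus: "x \<in> carrier A \<Longrightarrow> g (\<ominus>\<^bsub>A\<^esub> x) = \<ominus>\<^bsub>B\<^esub> g x"
  using hom_mult[of "A.scal (- 1)" x] by (simp add: A.minus_one_mult B.minus_one_mult hom_closed hom_scal)

lemma hom_minus: "\<lbrakk>x \<in> carrier A; y \<in> carrier A\<rbrakk> \<Longrightarrow> g (x \<ominus>\<^bsub>A\<^esub> y) = g x \<ominus>\<^bsub>B\<^esub> g y"
  by (simp add: A.minus_eq B.minus_eq hom_add hom_uminus)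

lemma hom_sa_le:
  assumes "sa_le A a b" and a: "a \<in> sa A" and b: "b \<in> sa A"
  shows "sa_le B (g a) (g b)"
proof -
  obtain c where c: "c \<in> sa A" "b \<ominus>\<^bsub>A\<^esub> a = c \<otimes>\<^bsub>A\<^esub> c"
    using assms(1) by (auto simp: sa_le_def)
  have "g b \<ominus>\<^bsub>B\<^esub> g a = g c \<otimes>\<^bsub>B\<^esub> g c"
    using c(2) hom_minus[OF A.sa_closed[OF b] A.sa_closed[OF a]] hom_mult[OF A.sa_closed A.sa_closed, OF c(1) c(1)]
    by simp
  then show ?thesis unfolding sa_le_def using hom_sa[OF c(1)] by blast
qed

lemma hom_lterms: "t \<in> lterms A \<Longrightarrow> map_lterm g t \<in> lterms B"
  by (induction t) (auto simp: hom_sa)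

lemma hom_shift: "t \<in> lterms A \<Longrightarrow> map_lterm g (A.shift r t) = B.shift r (map_lterm g t)"
  by (induction t) (auto simp: hom_minus hom_scal A.sa_closed)

lemma hom_lterm_le: "lterm_le A s t \<Longrightarrow> lterm_le B (map_lterm g s) (map_lterm g t)"
proof (induction rule: lterm_le.induct)
  case (trans r s t)
  show ?case by (rule lterm_le.trans[OF trans.IH])
next
  case (D_disjoint a)
  then show ?case using lterm_le.D_disjoint[of "g a" B] by (simp add: hom_sa hom_uminus A.sa_closed)
next
  case (D_nonpos a)
  have "g \<zero>\<^bsub>A\<^esub> = \<zero>\<^bsub>B\<^esub>" using hom_scal[of 0] by (simp add: A.scal_0 B.scal_0)
  then show ?case using lterm_le.D_nonpos[of "g a" B] hom_sa_le[OF D_nonpos(2)] D_nonpos(1)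
    by (simp add: hom_sa)
next
  case (D_add a b)
  then show ?case using lterm_le.D_add[of "g a" B "g b"] by (simp add: hom_sa hom_add A.sa_closed)
next
  case D_one
  then show ?case using lterm_le.D_one[of B] ring_hom_one[OF ring_hom] by simp
next
  case (D_mult1 a b)
  then show ?case using lterm_le.D_mult1[of "g a" B "g b"]
    by (simp add: hom_sa hom_mult hom_uminus A.sa_closed)
next
  case (D_mult2 a b)
  then show ?case using lterm_le.D_mult2[of "g a" B "g b"]
    by (simp add: hom_sa hom_mult hom_uminus A.sa_closed)
qed (simp_all add: hom_lterms lterm_le.refl lterm_le.top lterm_le.bot lterm_le.meet1 lterm_le.meet2
  lterm_le.meetI lterm_le.join1 lterm_le.join2 lterm_le.joinE lterm_le.distrib)

text \<open>Homomorphisms preserve entailment, so the union defining \<open>Lat_map\<close> consists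
  of copies of one and the same class.\<close>

lemma Lat_map_lclass:
  assumes t: "t \<in> lterms A"
  shows "Lat_map B g (lclass A t) = lclass B (map_lterm g t)"
proof -
  have "lclass B (map_lterm g s) = lclass B (map_lterm g t)" if "s \<in> lclass A t" for s
    using that hom_lterm_le by (intro B.lclass_eqI) (auto simp: lclass_def)
  then show ?thesis unfolding Lat_map_def using A.lclass_self[OF t] by blast
qed

lemma Lat_map_interpolate:
  assumes a: "X \<in> carrier (Lat A)" and a': "rather_below (Lat B) Y (Lat_map B g X)"
  shows "\<exists>Z. rather_below (Lat A) Z X \<and> Y \<sqsubseteq>\<^bsub>Lat B\<^esub> Lat_map B g Z"
proof -
  obtain t where t: "X = lclass A t" "t \<in> lterms A" using a by auto
  obtain s where s: "Y = lclass B s" "s \<in> lterms B" using a' by (auto simp: rather_below_def)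
  have gt: "map_lterm g t \<in> lterms B" using hom_lterms t by blast
  obtain y where "lterm_le B (LMeet s y) LBot" "lterm_le B LTop (LJoin (map_lterm g t) y)"
    using a' s(2) gt by (auto simp: s(1) t Lat_map_lclass B.rather_below_Lat_iff)
  \<comment> \<open>The amount \<open>r\<close> is found in \<open>B\<close>, but the shift by it
    can already be formed in \<open>A\<close>.\<close>
  then obtain r where r: "0 < r" "lterm_le B s (B.shift r (map_lterm g t))"
    using B.rather_below_shift by blast
  have st: "A.shift r t \<in> lterms A" using t(2) by simp
  have "rather_below (Lat A) (lclass A (A.shift r t)) X"
    using A.shift_rather_below[OF t(2) r(1)] st t by (simp add: A.rather_below_Lat_iff)
  moreover have "Y \<sqsubseteq>\<^bsub>Lat B\<^esub> Lat_map B g (lclass A (A.shift r t))"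
    using r(2) s gt t(2) st by (simp add: Lat_map_lclass hom_shift)
  ultimately show ?thesis by blast
qed

end

section \<open>Opens over an interpolating internal lattice\<close>

lemma rspec_opens_Inter:
  assumes "\<V> \<subseteq> rspec_opens L" and "\<V> \<noteq> {}"
  shows "\<Inter>\<V> \<in> rspec_opens L"
proof -
  have V: "V \<in> rspec_opens L" if "V \<in> \<V>" for V using assms(1) that by blast
  show ?thesis
    unfolding rspec_opens_def mem_Collect_eq
  proof (intro conjI ballI impI)
    show "\<Inter>\<V> \<subseteq> carrier L"
      using assms(2) V unfolding rspec_opens_def by blast
    show "\<bottom>\<^bsub>L\<^esub> \<in> \<Inter>\<V>"
      using V unfolding rspec_opens_def by blast
    show "b \<in> \<Inter>\<V>" if "a \<in> \<Inter>\<V>" "b \<in> carrier L" "b \<sqsubseteq>\<^bsub>L\<^esub> a" for a b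
      using V that unfolding rspec_opens_def by blast
    show "a \<squnion>\<^bsub>L\<^esub> b \<in> \<Inter>\<V>" if "a \<in> \<Inter>\<V>" "b \<in> \<Inter>\<V>" for a b
      using V that unfolding rspec_opens_def by blast
    show "a \<sqinter>\<^bsub>L\<^esub> b \<in> \<Inter>\<V>" if "a \<in> carrier L" "b \<in> carrier L"
      "\<forall>a'. rather_below L a' a \<longrightarrow> a' \<sqinter>\<^bsub>L\<^esub> b \<in> \<Inter>\<V>" for a b
      using V that unfolding rspec_opens_def by blast
  qed
qed

lemma carrier_rspec_opens:
  assumes "bounded_lattice L"
  shows "carrier L \<in> rspec_opens L"
proof -
  interpret bounded_lattice L by (rule assms)
  show ?thesis unfolding rspec_opens_def by auto
qed

lemma rspec_gen_open:
  assumes "bounded_lattice L" and "S \<subseteq> carrier L"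
  shows "rspec_gen L S \<in> rspec_opens L"
  unfolding rspec_gen_def
  by (rule rspec_opens_Inter) (use carrier_rspec_opens[OF assms(1)] assms(2) in blast)+

lemma rspec_gen_superset: "S \<subseteq> rspec_gen L S"
  by (auto simp: rspec_gen_def)

lemma rspec_gen_least: "\<lbrakk>V \<in> rspec_opens L; S \<subseteq> V\<rbrakk> \<Longrightarrow> rspec_gen L S \<subseteq> V"
  by (auto simp: rspec_gen_def)

text \<open>As \<open>V\<close> is open, it contains the generated open as soon as it contains the
  generators. Compatibility of families thus becomes an elementwise condition.\<close>

lemma rspec_inv_image_subset_iff:
  assumes "V \<in> rspec_opens L'"
  shows "rspec_inv_image L' h U \<subseteq> V \<longleftrightarrow> h ` U \<subseteq> V"
  unfolding rspec_inv_image_def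
  using rspec_gen_least[OF assms] rspec_gen_superset[of "h ` U" L'] by blast

text \<open>The crux is \<open>interpolate\<close>: it makes the internal cover of an element, which ranges
  over all later stages, no finer than its cover at the present stage.\<close>

locale interpolating_lattice = small_category CC
  for CC :: "('o, 'm) category" +
  fixes L :: "'o \<Rightarrow> 'l gorder" and h :: "'m \<Rightarrow> 'l \<Rightarrow> 'l"
  assumes bounded: "C \<in> Obj CC \<Longrightarrow> bounded_lattice (L C)"
    and map_closed: "\<lbrakk>f \<in> Arr CC; a \<in> carrier (L (Dom CC f))\<rbrakk> \<Longrightarrow> h f a \<in> carrier (L (Cod CC f))"
    and map_Id: "\<lbrakk>C \<in> Obj CC; a \<in> carrier (L C)\<rbrakk> \<Longrightarrow> h (Id CC C) a = a"
    and map_bottom: "f \<in> Arr CC \<Longrightarrow> h f \<bottom>\<^bsub>L (Dom CC f)\<^esub> = \<bottom>\<^bsub>L (Cod CC f)\<^esub>"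
    and map_join: "\<lbrakk>f \<in> Arr CC; a \<in> carrier (L (Dom CC f)); b \<in> carrier (L (Dom CC f))\<rbrakk> \<Longrightarrow>
      h f (a \<squnion>\<^bsub>L (Dom CC f)\<^esub> b) = h f a \<squnion>\<^bsub>L (Cod CC f)\<^esub> h f b"
    and map_meet: "\<lbrakk>f \<in> Arr CC; a \<in> carrier (L (Dom CC f)); b \<in> carrier (L (Dom CC f))\<rbrakk> \<Longrightarrow>
      h f (a \<sqinter>\<^bsub>L (Dom CC f)\<^esub> b) = h f a \<sqinter>\<^bsub>L (Cod CC f)\<^esub> h f b"
    and interpolate: "\<lbrakk>f \<in> Arr CC; a \<in> carrier (L (Dom CC f)); rather_below (L (Cod CC f)) a' (h f a)\<rbrakk> \<Longrightarrow>
      \<exists>a''. rather_below (L (Dom CC f)) a'' a \<and> a' \<sqsubseteq>\<^bsub>L (Cod CC f)\<^esub> h f a''"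
begin

section \<open>The internal frame and its stages\<close>

abbreviation F :: "'o \<Rightarrow> ('m \<Rightarrow> 'l set) gorder" where
  "F \<equiv> int_rspec CC L h"

abbreviation t :: "'m \<Rightarrow> ('m \<Rightarrow> 'l set) \<Rightarrow> 'm \<Rightarrow> 'l set" where
  "t \<equiv> int_rspec_map CC"

lemma lattice: "C \<in> Obj CC \<Longrightarrow> lattice (L C)"
  using bounded by (simp add: bounded_lattice_def)

lemma carrier_F: "carrier (F C) = int_rspec_opens CC L h C"
  by (simp add: int_rspec_def)

lemma le_F: "I \<sqsubseteq>\<^bsub>F C\<^esub> J \<longleftrightarrow> (\<forall>f. I f \<subseteq> J f)"
  by (simp add: int_rspec_def)

lemma arrows_from_Obj: "f \<in> arrows_from CC C \<Longrightarrow> f \<in> Arr CC \<and> Dom CC f = C \<and> C \<in> Obj CC \<and> Cod CC f \<in> Obj CC"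
  using dom_cod by (auto simp: arrows_from_def)

lemma Id_arrows_from: "C \<in> Obj CC \<Longrightarrow> Id CC C \<in> arrows_from CC C"
  using id_arr by (auto simp: arrows_from_def)

lemma Comp_arrows_from:
  "\<lbrakk>f \<in> arrows_from CC C; g \<in> arrows_from CC (Cod CC f)\<rbrakk> \<Longrightarrow>
    Comp CC g f \<in> arrows_from CC C \<and> Cod CC (Comp CC g f) = Cod CC g"
  using comp_arr by (auto simp: arrows_from_def)

lemma Comp_assoc_arrows_from:
  "\<lbrakk>f \<in> arrows_from CC C; g \<in> arrows_from CC (Cod CC f); k \<in> arrows_from CC (Cod CC g)\<rbrakk> \<Longrightarrow>
    Comp CC k (Comp CC g f) = Comp CC (Comp CC k g) f"
  using comp_assoc by (auto simp: arrows_from_def)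

lemma Comp_Id_left: "f \<in> arrows_from CC C \<Longrightarrow> Comp CC (Id CC (Cod CC f)) f = f"
  using id_left by (auto simp: arrows_from_def)

lemma Comp_Id_right: "f \<in> arrows_from CC C \<Longrightarrow> Comp CC f (Id CC C) = f"
  using id_right by (auto simp: arrows_from_def)

text \<open>Carries the premise of the covering condition along \<open>f\<close>: with an
  interpolant \<open>a''\<close>, the meet of \<open>a'\<close> and \<open>h f b\<close> lies below
  the image of the meet of \<open>a''\<close> and \<open>b\<close>. Of \<open>V\<close> only
  downward closure is required, so the lemma applies to components not yet known to be open.\<close>

lemma cover_transport:
  assumes f: "f \<in> arrows_from CC C" and V: "V \<subseteq> carrier (L (Cod CC f))"
    and down: "\<forall>a\<in>V. \<forall>b\<in>carrier (L (Cod CC f)). b \<sqsubseteq>\<^bsub>L (Cod CC f)\<^esub> a \<longrightarrow> b \<in> V"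
    and a: "a \<in> carrier (L C)" and b: "b \<in> carrier (L C)"
    and hyp: "\<And>a'. rather_below (L C) a' a \<Longrightarrow> h f (a' \<sqinter>\<^bsub>L C\<^esub> b) \<in> V"
    and a': "rather_below (L (Cod CC f)) a' (h f a)"
  shows "a' \<sqinter>\<^bsub>L (Cod CC f)\<^esub> h f b \<in> V"
proof -
  have f': "f \<in> Arr CC" "Dom CC f = C" "Cod CC f \<in> Obj CC"
    using arrows_from_Obj[OF f] by auto
  interpret lattice "L (Cod CC f)" by (rule lattice[OF f'(3)])
  obtain a'' where a'': "rather_below (L C) a'' a" "a' \<sqsubseteq>\<^bsub>L (Cod CC f)\<^esub> h f a''"
    using interpolate[OF f'(1), of a a'] f'(2) a a' by auto
  have c: "a'' \<in> carrier (L C)" "a' \<in> carrier (L (Cod CC f))"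
    using a'' a' by (auto simp: rather_below_def)
  have hc: "h f a'' \<in> carrier (L (Cod CC f))" "h f b \<in> carrier (L (Cod CC f))"
    using map_closed f' c b by auto
  have "h f a'' \<sqinter>\<^bsub>L (Cod CC f)\<^esub> h f b \<in> V"
    using hyp[OF a''(1)] map_meet[OF f'(1), of a'' b] f'(2) c b by simp
  moreover have "a' \<sqinter>\<^bsub>L (Cod CC f)\<^esub> h f b \<sqsubseteq>\<^bsub>L (Cod CC f)\<^esub> h f a'' \<sqinter>\<^bsub>L (Cod CC f)\<^esub> h f b"
    using c hc a''(2) by (intro meet_le le_trans[OF meet_left a''(2)] meet_right) auto
  ultimately show ?thesis using down c hc by auto
qed

lemma map_le:
  assumes "f \<in> Arr CC" "a \<in> carrier (L (Dom CC f))" "b \<in> carrier (L (Dom CC f))" "a \<sqsubseteq>\<^bsub>L (Dom CC f)\<^esub> b"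
  shows "h f a \<sqsubseteq>\<^bsub>L (Cod CC f)\<^esub> h f b"
proof -
  interpret D: lattice "L (Dom CC f)" using lattice assms(1) dom_cod by blast
  interpret E: lattice "L (Cod CC f)" using lattice assms(1) dom_cod by blast
  have "h f a \<squnion>\<^bsub>L (Cod CC f)\<^esub> h f b = h f b"
    using map_join[OF assms(1-3)] D.le_iff_meet assms by simp
  then show ?thesis using E.le_iff_meet map_closed assms by simp
qed

text \<open>Preimages of ideals under lattice homomorphisms are ideals, and the covering condition
  pulls back by \<open>cover_transport\<close>. This extends an inclusion of generators to the open
  they generate.\<close>

lemma vimage_rspec_opens:
  assumes f: "f \<in> arrows_from CC C" and V: "V \<in> rspec_opens (L (Cod CC f))"
  shows "{a \<in> carrier (L C). h f a \<in> V} \<in> rspec_opens (L C)"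
proof -
  have f': "f \<in> Arr CC" "Dom CC f = C" "C \<in> Obj CC" "Cod CC f \<in> Obj CC"
    using arrows_from_Obj[OF f] by auto
  interpret D: bounded_lattice "L C" by (rule bounded[OF f'(3)])
  have m: "h f a \<in> carrier (L (Cod CC f))" if "a \<in> carrier (L C)" for a
    using map_closed f' that by auto
  have Vs: "V \<subseteq> carrier (L (Cod CC f))"
    and Vd: "\<forall>a\<in>V. \<forall>b\<in>carrier (L (Cod CC f)). b \<sqsubseteq>\<^bsub>L (Cod CC f)\<^esub> a \<longrightarrow> b \<in> V"
    and Vb: "\<bottom>\<^bsub>L (Cod CC f)\<^esub> \<in> V"
    and Vj: "\<forall>a\<in>V. \<forall>b\<in>V. a \<squnion>\<^bsub>L (Cod CC f)\<^esub> b \<in> V"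
    and Vc: "\<forall>a\<in>carrier (L (Cod CC f)). \<forall>b\<in>carrier (L (Cod CC f)).
        (\<forall>a'. rather_below (L (Cod CC f)) a' a \<longrightarrow> a' \<sqinter>\<^bsub>L (Cod CC f)\<^esub> b \<in> V) \<longrightarrow> a \<sqinter>\<^bsub>L (Cod CC f)\<^esub> b \<in> V"
    using V unfolding rspec_opens_def by auto
  show ?thesis
    unfolding rspec_opens_def mem_Collect_eq
  proof (intro conjI ballI impI, goal_cases)
    case 1 then show ?case by auto
  next
    case (2 a b) then show ?case by simp
  next
    case (3 a b)
    then have "h f b \<sqsubseteq>\<^bsub>L (Cod CC f)\<^esub> h f a" using map_le[of f b a] f' by simp
    then show ?case using Vd m 3 by blast
  next
    case 4 then show ?case by simp
  next
    case 5 then show ?case using Vb map_bottom[OF f'(1)] f' by simp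
  next
    case (6 a b) then show ?case by simp
  next
    case (7 a b) then show ?case using Vj map_join[of f a b] f' by auto
  next
    case (8 a b) then show ?case by simp
  next
    case (9 a b)
    have "a' \<sqinter>\<^bsub>L (Cod CC f)\<^esub> h f b \<in> V" if "rather_below (L (Cod CC f)) a' (h f a)" for a'
      using cover_transport[OF f Vs Vd 9(1,2) _ that] 9(3) by auto
    then have "h f a \<sqinter>\<^bsub>L (Cod CC f)\<^esub> h f b \<in> V" using Vc m 9(1,2) by blast
    then show ?case using map_meet[of f a b] 9 f' by auto
  qed
qed

text \<open>If the covering premise holds at the present stage, stability under transitions and
  \<open>cover_transport\<close> give it at all later stages, so the internal condition applies.
  Conversely, the internal premise contains the stagewise one at the identity arrow.\<close>

lemma int_rspec_opens_iff:
  assumes C: "C \<in> Obj CC"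
  shows "I \<in> int_rspec_opens CC L h C \<longleftrightarrow>
     (\<forall>f. f \<notin> arrows_from CC C \<longrightarrow> I f = {}) \<and>
     (\<forall>f\<in>arrows_from CC C. I f \<in> rspec_opens (L (Cod CC f)) \<and>
        (\<forall>g\<in>arrows_from CC (Cod CC f). \<forall>a\<in>I f. h g a \<in> I (Comp CC g f)))"
  (is "?l \<longleftrightarrow> ?r")
proof
  assume ?l
  note l = this[unfolded int_rspec_opens_def mem_Collect_eq Let_def]
  note l1 = l[THEN conjunct2, THEN conjunct1, THEN bspec]
  note l2 = l[THEN conjunct2, THEN conjunct2, THEN bspec]
  have "I f \<in> rspec_opens (L (Cod CC f))" if f: "f \<in> arrows_from CC C" for f
    unfolding rspec_opens_def mem_Collect_eq
  proof (intro conjI)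
    let ?M = "L (Cod CC f)"
    note l2f = l2[OF f]
    show "I f \<subseteq> carrier ?M" by (rule l1[OF f, THEN conjunct1])
    show "\<forall>a\<in>I f. \<forall>b\<in>carrier ?M. b \<sqsubseteq>\<^bsub>?M\<^esub> a \<longrightarrow> b \<in> I f"
      by (rule l2f[THEN conjunct1])
    show "\<bottom>\<^bsub>?M\<^esub> \<in> I f" by (rule l2f[THEN conjunct2, THEN conjunct1])
    show "\<forall>a\<in>I f. \<forall>b\<in>I f. a \<squnion>\<^bsub>?M\<^esub> b \<in> I f"
      by (rule l2f[THEN conjunct2, THEN conjunct2, THEN conjunct1])
    note reg = l2f[THEN conjunct2, THEN conjunct2, THEN conjunct2, rule_format]
    show "\<forall>a\<in>carrier ?M. \<forall>b\<in>carrier ?M. (\<forall>a'. rather_below ?M a' a \<longrightarrow> a' \<sqinter>\<^bsub>?M\<^esub> b \<in> I f) \<longrightarrow> a \<sqinter>\<^bsub>?M\<^esub> b \<in> I f"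
    proof (intro ballI impI)
      fix a b assume ab: "a \<in> carrier ?M" "b \<in> carrier ?M"
        and hyp: "\<forall>a'. rather_below ?M a' a \<longrightarrow> a' \<sqinter>\<^bsub>?M\<^esub> b \<in> I f"
      show "a \<sqinter>\<^bsub>?M\<^esub> b \<in> I f"
      proof (rule reg[OF ab])
        fix g a' assume g: "g \<in> arrows_from CC (Cod CC f)" and a': "rather_below (L (Cod CC g)) a' (h g a)"
        have gf: "Comp CC g f \<in> arrows_from CC C" "Cod CC (Comp CC g f) = Cod CC g"
          using Comp_arrows_from[OF f g] by auto
        show "a' \<sqinter>\<^bsub>L (Cod CC g)\<^esub> h g b \<in> I (Comp CC g f)"
        proof (rule cover_transport[OF g _ _ ab _ a'])
          show "I (Comp CC g f) \<subseteq> carrier (L (Cod CC g))"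
            using l1[OF gf(1), THEN conjunct1] unfolding gf(2) .
          show "\<forall>a\<in>I (Comp CC g f). \<forall>b\<in>carrier (L (Cod CC g)). b \<sqsubseteq>\<^bsub>L (Cod CC g)\<^esub> a \<longrightarrow> b \<in> I (Comp CC g f)"
            using l2[OF gf(1), THEN conjunct1] unfolding gf(2) .
          show "h g (a'' \<sqinter>\<^bsub>?M\<^esub> b) \<in> I (Comp CC g f)" if "rather_below ?M a'' a" for a''
            using l1[OF f, THEN conjunct2] g hyp that by blast
        qed
      qed
    qed
  qed
  with l[THEN conjunct1] l1 show ?r by blast
next
  assume r: ?r
  have I: "I f \<in> rspec_opens (L (Cod CC f))" if "f \<in> arrows_from CC C" for f
    using r that by blast
  note I' = I[unfolded rspec_opens_def mem_Collect_eq]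
  have reg: "a \<sqinter>\<^bsub>L (Cod CC f)\<^esub> b \<in> I f"
    if f: "f \<in> arrows_from CC C" and ab: "a \<in> carrier (L (Cod CC f))" "b \<in> carrier (L (Cod CC f))"
      and hyp: "\<forall>g\<in>arrows_from CC (Cod CC f). \<forall>a'. rather_below (L (Cod CC g)) a' (h g a) \<longrightarrow>
              a' \<sqinter>\<^bsub>L (Cod CC g)\<^esub> h g b \<in> I (Comp CC g f)" for f a b
  proof -
    have C': "Cod CC f \<in> Obj CC" using arrows_from_Obj[OF f] by auto
    have "a' \<sqinter>\<^bsub>L (Cod CC f)\<^esub> b \<in> I f" if "rather_below (L (Cod CC f)) a' a" for a'
      using hyp[rule_format, OF Id_arrows_from[OF C']] that id_arr[OF C'] map_Id[OF C'] ab
        Comp_Id_left[OF f] by simp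
    then show ?thesis
      using I'[OF f, THEN conjunct2, THEN conjunct2, THEN conjunct2, THEN conjunct2] ab by blast
  qed
  show ?l
    unfolding int_rspec_opens_def mem_Collect_eq Let_def
  proof (intro conjI[OF r[THEN conjunct1]] conjI ballI)
    fix f assume f: "f \<in> arrows_from CC C"
    show "I f \<subseteq> carrier (L (Cod CC f))" by (rule I'[OF f, THEN conjunct1])
    show "\<bottom>\<^bsub>L (Cod CC f)\<^esub> \<in> I f" using I'[OF f] by blast
    show "h g a \<in> I (Comp CC g f)" if "g \<in> arrows_from CC (Cod CC f)" "a \<in> I f" for g a
      using r f that by blast
    show "b \<sqsubseteq>\<^bsub>L (Cod CC f)\<^esub> a \<longrightarrow> b \<in> I f" if "a \<in> I f" "b \<in> carrier (L (Cod CC f))" for a b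
      using I'[OF f, THEN conjunct2, THEN conjunct1] that by blast
    show "a \<squnion>\<^bsub>L (Cod CC f)\<^esub> b \<in> I f" if "a \<in> I f" "b \<in> I f" for a b
      using I'[OF f, THEN conjunct2, THEN conjunct2, THEN conjunct2, THEN conjunct1] that by blast
  qed (use reg in blast)
qed

lemma carrier_F_E:
  assumes I: "I \<in> carrier (F C)" and f: "f \<in> arrows_from CC C"
  shows "I f \<in> rspec_opens (L (Cod CC f))"
    and "I f \<subseteq> carrier (L (Cod CC f))"
    and "\<lbrakk>g \<in> arrows_from CC (Cod CC f); a \<in> I f\<rbrakk> \<Longrightarrow> h g a \<in> I (Comp CC g f)"
proof -
  have C: "C \<in> Obj CC" using arrows_from_Obj[OF f] by simp
  note I' = I[unfolded carrier_F int_rspec_opens_iff[OF C], THEN conjunct2, rule_format, OF f]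
  show *: "I f \<in> rspec_opens (L (Cod CC f))" by (rule I'[THEN conjunct1])
  show "I f \<subseteq> carrier (L (Cod CC f))"
    using * unfolding rspec_opens_def mem_Collect_eq by (rule conjunct1)
  show "\<lbrakk>g \<in> arrows_from CC (Cod CC f); a \<in> I f\<rbrakk> \<Longrightarrow> h g a \<in> I (Comp CC g f)"
    using I'[THEN conjunct2] by blast
qed

lemma int_rspec_map_closed:
  assumes f: "f \<in> arrows_from CC C" and I: "I \<in> carrier (F C)"
  shows "t f I \<in> carrier (F (Cod CC f))"
proof -
  have obj: "C \<in> Obj CC" "Cod CC f \<in> Obj CC" using arrows_from_Obj[OF f] by auto
  have "I (Comp CC g f) \<in> rspec_opens (L (Cod CC g))"
    and "\<And>k a. \<lbrakk>k \<in> arrows_from CC (Cod CC g); a \<in> I (Comp CC g f)\<rbrakk> \<Longrightarrow> h k a \<in> I (Comp CC (Comp CC k g) f)"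
    if g: "g \<in> arrows_from CC (Cod CC f)" for g
    using carrier_F_E(1,3)[OF I conjunct1[OF Comp_arrows_from[OF f g]]]
      Comp_arrows_from[OF f g] Comp_assoc_arrows_from[OF f g] by simp_all
  then show ?thesis
    unfolding carrier_F int_rspec_opens_iff[OF obj(2)] int_rspec_map_def
    using Comp_arrows_from by auto
qed

section \<open>Compatible families and the opens they describe\<close>

definition families :: "('o \<Rightarrow> 'l set) set" where
  "families = {U \<in> (\<Pi>\<^sub>E C\<in>Obj CC. rspec_opens (L C)).
     \<forall>f\<in>Arr CC. rspec_inv_image (L (Cod CC f)) (h f) (U (Dom CC f)) \<subseteq> U (Cod CC f)}"

text \<open>The family seen as an element of the internal frame at stage \<open>C\<close>: the
  component at an arrow depends on its codomain only. It will be the largest member of the open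
  described by \<open>U\<close> at that stage.\<close>

definition restrict_family :: "('o \<Rightarrow> 'l set) \<Rightarrow> 'o \<Rightarrow> 'm \<Rightarrow> 'l set" where
  "restrict_family U C f = (if f \<in> arrows_from CC C then U (Cod CC f) else {})"

definition family_open :: "('o \<Rightarrow> 'l set) \<Rightarrow> 'o \<Rightarrow> ('m \<Rightarrow> 'l set) \<Rightarrow> unit set" where
  "family_open U C I =
     {x. C \<in> Obj CC \<and> I \<in> carrier (F C) \<and> (\<forall>f\<in>arrows_from CC C. I f \<subseteq> U (Cod CC f))}"

lemma families_iff:
  "U \<in> families \<longleftrightarrow> U \<in> (\<Pi>\<^sub>E C\<in>Obj CC. rspec_opens (L C)) \<and>
     (\<forall>C. \<forall>f\<in>arrows_from CC C. h f ` U C \<subseteq> U (Cod CC f))"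
proof -
  have *: "rspec_inv_image (L (Cod CC f)) (h f) (U (Dom CC f)) \<subseteq> U (Cod CC f) \<longleftrightarrow>
      h f ` U (Dom CC f) \<subseteq> U (Cod CC f)"
    if "U \<in> (\<Pi>\<^sub>E C\<in>Obj CC. rspec_opens (L C))" "f \<in> Arr CC" for f
    by (rule rspec_inv_image_subset_iff) (use that dom_cod in blast)
  show ?thesis
    unfolding families_def arrows_from_def mem_Collect_eq
    by (rule conj_cong[OF HOL.refl]) (simp add: * Ball_def)
qed

text \<open>By the stagewise description of internal opens, the openness of each component and the
  compatibility of \<open>U\<close> are exactly what is required.\<close>

lemma restrict_family_closed:
  assumes "U \<in> families" and C: "C \<in> Obj CC"
  shows "restrict_family U C \<in> carrier (F C)"
proof -
  have U: "\<And>D. D \<in> Obj CC \<Longrightarrow> U D \<in> rspec_opens (L D)"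
    and st: "\<And>D g. g \<in> arrows_from CC D \<Longrightarrow> h g ` U D \<subseteq> U (Cod CC g)"
    using assms(1) unfolding families_iff by blast+
  show ?thesis
    unfolding carrier_F int_rspec_opens_iff[OF C]
  proof (intro conjI ballI allI impI)
    fix f assume f: "f \<in> arrows_from CC C"
    show "restrict_family U C f \<in> rspec_opens (L (Cod CC f))"
      using U arrows_from_Obj[OF f] f by (simp add: restrict_family_def)
    show "h g a \<in> restrict_family U C (Comp CC g f)"
      if g: "g \<in> arrows_from CC (Cod CC f)" and a: "a \<in> restrict_family U C f" for g a
      using st[OF g] a f Comp_arrows_from[OF f g] by (auto simp: restrict_family_def)
  qed (simp add: restrict_family_def)
qed

lemma le_restrict_family_iff:
  assumes "I \<in> carrier (F C)" "C \<in> Obj CC"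
  shows "I \<sqsubseteq>\<^bsub>F C\<^esub> restrict_family U C \<longleftrightarrow> (\<forall>f\<in>arrows_from CC C. I f \<subseteq> U (Cod CC f))"
proof -
  have "I f = {}" if "f \<notin> arrows_from CC C" for f
    using assms(1)[unfolded carrier_F int_rspec_opens_iff[OF assms(2)], THEN conjunct1] that by blast
  then show ?thesis unfolding le_F restrict_family_def by auto
qed

text \<open>The restrictions of \<open>U\<close> to the various stages fit together to a global
  element of the internal frame.\<close>

lemma int_rspec_map_restrict_family:
  "f \<in> arrows_from CC C \<Longrightarrow> t f (restrict_family U C) = restrict_family U (Cod CC f)"
  unfolding int_rspec_map_def restrict_family_def by (rule ext) (simp add: Comp_arrows_from)

lemma family_open_iff:
  "x \<in> family_open U C I \<longleftrightarrow> C \<in> Obj CC \<and> I \<in> carrier (F C) \<and> I \<sqsubseteq>\<^bsub>F C\<^esub> restrict_family U C"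
  unfolding family_open_def mem_Collect_eq using le_restrict_family_iff by blast

text \<open>For the converse, test the inclusion on the largest member
  \<open>restrict_family U C\<close>; its component at the identity arrow is
  \<open>U C\<close>.\<close>

lemma family_open_mono_iff:
  assumes "U \<in> families" and "V \<in> families"
  shows "(\<forall>C\<in>Obj CC. U C \<subseteq> V C) \<longleftrightarrow> (\<forall>C I. family_open U C I \<subseteq> family_open V C I)"
proof
  assume "\<forall>C\<in>Obj CC. U C \<subseteq> V C"
  then show "\<forall>C I. family_open U C I \<subseteq> family_open V C I"
    unfolding family_open_def using arrows_from_Obj by blast
next
  assume *: "\<forall>C I. family_open U C I \<subseteq> family_open V C I"
  show "\<forall>C\<in>Obj CC. U C \<subseteq> V C"
  proof
    fix C assume C: "C \<in> Obj CC"
    have "() \<in> family_open U C (restrict_family U C)"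
      using C restrict_family_closed[OF assms(1) C] by (simp add: family_open_iff le_F)
    then have "() \<in> family_open V C (restrict_family U C)" using * by blast
    then have "restrict_family U C (Id CC C) \<subseteq> V (Cod CC (Id CC C))"
      using Id_arrows_from[OF C] unfolding family_open_def by blast
    then show "U C \<subseteq> V C"
      using Id_arrows_from[OF C] id_arr[OF C] by (simp add: restrict_family_def)
  qed
qed

section \<open>Opens of the topos of internal sheaves\<close>

lemma F_trans: "\<lbrakk>I \<sqsubseteq>\<^bsub>F C\<^esub> J; J \<sqsubseteq>\<^bsub>F C\<^esub> K\<rbrakk> \<Longrightarrow> I \<sqsubseteq>\<^bsub>F C\<^esub> K"
  unfolding le_F by blast

lemma int_rspec_map_mono: "I \<sqsubseteq>\<^bsub>F C\<^esub> J \<Longrightarrow> t f I \<sqsubseteq>\<^bsub>F C'\<^esub> t f J"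
  unfolding le_F int_rspec_map_def by auto

lemma int_rspec_map_Id:
  assumes "C \<in> Obj CC" "I \<in> carrier (F C)"
  shows "t (Id CC C) I = I"
  using assms id_arr[OF assms(1)]
  unfolding carrier_F int_rspec_opens_iff[OF assms(1)] int_rspec_map_def
  by (intro ext) (simp add: Comp_Id_right)

text \<open>Sections and gluing carry no information in the terminal sheaf, so a subsheaf of it is a
  set of internal opens that is closed downwards, under transitions and under internal joins.\<close>

lemma topos_opens_iff:
  "P \<in> topos_opens CC F t \<longleftrightarrow>
     (\<forall>C u. P C u \<noteq> {} \<longrightarrow> C \<in> Obj CC \<and> u \<in> carrier (F C)) \<and>
     (\<forall>C u v. P C u \<noteq> {} \<longrightarrow> v \<in> carrier (F C) \<longrightarrow> v \<sqsubseteq>\<^bsub>F C\<^esub> u \<longrightarrow> P C v \<noteq> {}) \<and>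
     (\<forall>C u. \<forall>f\<in>arrows_from CC C. P C u \<noteq> {} \<longrightarrow> P (Cod CC f) (t f u) \<noteq> {}) \<and>
     (\<forall>C\<in>Obj CC. \<forall>u\<in>carrier (F C). \<forall>S. int_covers CC F t C u S \<longrightarrow>
        (\<forall>f\<in>arrows_from CC C. \<forall>v\<in>S f. P (Cod CC f) v \<noteq> {}) \<longrightarrow> P C u \<noteq> {})"
  (is "?l \<longleftrightarrow> ?supp \<and> ?down \<and> ?trans \<and> ?glue")
proof
  let ?X = "terminal_sheaf\<lparr>sec := P\<rparr> :: ('o, 'm, 'm \<Rightarrow> 'l set, unit) int_presheaf"
  assume ?l
  then have 1: ?supp and X: "internal_sheaf CC F t ?X"
    unfolding topos_opens_def subsheaves_def by auto
  interpret X: internal_sheaf CC F t ?X by (rule X)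
  have 2: ?down
  proof (intro allI impI)
    fix C u v assume *: "P C u \<noteq> {}" "v \<in> carrier (F C)" "v \<sqsubseteq>\<^bsub>F C\<^esub> u"
    then have "() \<in> P C u" by auto
    then show "P C v \<noteq> {}" using X.res_closed[of C u v "()"] 1 * by (auto simp: terminal_sheaf_def)
  qed
  have 3: ?trans
  proof (intro allI ballI impI)
    fix C u f assume *: "f \<in> arrows_from CC C" "P C u \<noteq> {}"
    then have "() \<in> P C u" by auto
    then show "P (Cod CC f) (t f u) \<noteq> {}"
      using X.tr_closed[of f u "()"] 1 * arrows_from_Obj[OF *(1)] by (auto simp: terminal_sheaf_def)
  qed
  have 4: ?glue
  proof (intro ballI allI impI)
    fix C u S assume *: "C \<in> Obj CC" "u \<in> carrier (F C)" "int_covers CC F t C u S"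
      and ne: "\<forall>f\<in>arrows_from CC C. \<forall>v\<in>S f. P (Cod CC f) v \<noteq> {}"
    have "() \<in> P (Cod CC f) v" if "f \<in> arrows_from CC C" "v \<in> S f" for f v
    proof -
      have "P (Cod CC f) v \<noteq> {}" using ne that by blast
      then show ?thesis by auto
    qed
    then have "matching_family CC F t ?X C S (\<lambda>f v. ())"
      by (auto simp: matching_family_def terminal_sheaf_def)
    from X.glue[OF * this] show "P C u \<noteq> {}" by auto
  qed
  from 1 2 3 4 show "?supp \<and> ?down \<and> ?trans \<and> ?glue" by blast
next
  let ?X = "terminal_sheaf\<lparr>sec := P\<rparr> :: ('o, 'm, 'm \<Rightarrow> 'l set, unit) int_presheaf"
  assume r: "?supp \<and> ?down \<and> ?trans \<and> ?glue"
  then have 1: ?supp and 2: ?down and 3: ?trans and 4: ?glue by blast+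
  have unit: "x \<in> P C u" if "P C u \<noteq> {}" for x C u using that by auto
  have "internal_sheaf CC F t ?X"
  \<comment> \<open>Only closure under restriction, closure under transition and gluing have
    content; the other axioms are equations in \<open>unit\<close>.\<close>
  proof (unfold_locales, goal_cases)
    case (1 C u v x) then have "P C v \<noteq> {}" using 2 by auto
    then show ?case using unit by (auto simp: terminal_sheaf_def)
  next
    case (4 f u x)
    then have "P (Cod CC f) (t f u) \<noteq> {}" using 3 by (auto simp: arrows_from_def)
    then show ?case using unit by (auto simp: terminal_sheaf_def)
  next
    case (8 C u S x)
    have "\<forall>f\<in>arrows_from CC C. \<forall>v\<in>S f. P (Cod CC f) v \<noteq> {}"
      using 8(4) by (auto simp: matching_family_def terminal_sheaf_def)
    then have "P C u \<noteq> {}" using 4 8 by blast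
    then show ?case using unit by (auto simp: terminal_sheaf_def)
  qed (auto simp: terminal_sheaf_def)
  then show ?l using 1 unfolding topos_opens_def subsheaves_def by (auto simp: terminal_sheaf_def)
qed

text \<open>The point is gluing. If all members of a cover of \<open>u\<close> lie in the open, then
  the global element given by \<open>U\<close> is an upper bound of the cover at every stage; the
  join property at the identity arrow puts \<open>u\<close> below it.\<close>

lemma family_open_topos_open:
  assumes U: "U \<in> families"
  shows "family_open U \<in> topos_opens CC F t"
proof -
  have ne: "family_open U C I \<noteq> {} \<longleftrightarrow> C \<in> Obj CC \<and> I \<in> carrier (F C) \<and> I \<sqsubseteq>\<^bsub>F C\<^esub> restrict_family U C" for C I
    using family_open_iff[of _ U C I] by (metis all_not_in_conv)
  show ?thesis
    unfolding topos_opens_iff ne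
  proof (intro conjI allI ballI impI; (elim conjE)?)
    fix C u v assume "C \<in> Obj CC" "v \<in> carrier (F C)"
    then show "C \<in> Obj CC" "v \<in> carrier (F C)" .
  next
    fix C u v assume "u \<sqsubseteq>\<^bsub>F C\<^esub> restrict_family U C" "v \<sqsubseteq>\<^bsub>F C\<^esub> u"
    then show "v \<sqsubseteq>\<^bsub>F C\<^esub> restrict_family U C" using F_trans by blast
  next
    fix C u f assume f: "f \<in> arrows_from CC C" and "u \<in> carrier (F C)" "u \<sqsubseteq>\<^bsub>F C\<^esub> restrict_family U C"
    then show "t f u \<in> carrier (F (Cod CC f))" "t f u \<sqsubseteq>\<^bsub>F (Cod CC f)\<^esub> restrict_family U (Cod CC f)"
      using int_rspec_map_closed[OF f] int_rspec_map_mono[of C u "restrict_family U C" "Cod CC f" f]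
        int_rspec_map_restrict_family[OF f, of U] by simp_all
    show "Cod CC f \<in> Obj CC" using arrows_from_Obj[OF f] by simp
  next
    fix C u S assume C: "C \<in> Obj CC" and u: "u \<in> carrier (F C)"
      and cov: "int_covers CC F t C u S"
      and S: "\<forall>f\<in>arrows_from CC C. \<forall>v\<in>S f. Cod CC f \<in> Obj CC \<and> v \<in> carrier (F (Cod CC f)) \<and>
        v \<sqsubseteq>\<^bsub>F (Cod CC f)\<^esub> restrict_family U (Cod CC f)"
    have "t (Id CC C) u \<sqsubseteq>\<^bsub>F C\<^esub> restrict_family U C"
    proof -
      have "t (Id CC C) u \<sqsubseteq>\<^bsub>F (Cod CC (Id CC C))\<^esub> restrict_family U C"
      proof (rule cov[unfolded int_covers_def, THEN conjunct2, rule_format, OF Id_arrows_from[OF C]])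
        show "restrict_family U C \<in> carrier (F (Cod CC (Id CC C)))"
          using restrict_family_closed[OF U C] id_arr[OF C] by simp
        fix g v assume "g \<in> arrows_from CC (Cod CC (Id CC C))" "v \<in> S (Comp CC g (Id CC C))"
        then have "g \<in> arrows_from CC C" "v \<in> S g"
          using id_arr[OF C] Comp_Id_right[of g C] by auto
        then show "v \<sqsubseteq>\<^bsub>F (Cod CC g)\<^esub> t g (restrict_family U C)"
          using S int_rspec_map_restrict_family[of g C U] by simp
      qed
      then show ?thesis using id_arr[OF C] by simp
    qed
    then show "u \<sqsubseteq>\<^bsub>F C\<^esub> restrict_family U C" using int_rspec_map_Id[OF C u] by simp
  qed
qed

lemma topos_open_family_open:
  assumes P: "P \<in> topos_opens CC F t"
  obtains U where "U \<in> families" "P = family_open U"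
proof -
  have supp: "\<And>C u. P C u \<noteq> {} \<Longrightarrow> C \<in> Obj CC \<and> u \<in> carrier (F C)"
    and down: "\<And>C u v. \<lbrakk>P C u \<noteq> {}; v \<in> carrier (F C); v \<sqsubseteq>\<^bsub>F C\<^esub> u\<rbrakk> \<Longrightarrow> P C v \<noteq> {}"
    and trans: "\<And>C u f. \<lbrakk>f \<in> arrows_from CC C; P C u \<noteq> {}\<rbrakk> \<Longrightarrow> P (Cod CC f) (t f u) \<noteq> {}"
    and glue: "\<And>C u S. \<lbrakk>C \<in> Obj CC; u \<in> carrier (F C); int_covers CC F t C u S;
        \<forall>f\<in>arrows_from CC C. \<forall>v\<in>S f. P (Cod CC f) v \<noteq> {}\<rbrakk> \<Longrightarrow> P C u \<noteq> {}"
  proof -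
    note P' = P[unfolded topos_opens_iff]
    show "\<And>C u. P C u \<noteq> {} \<Longrightarrow> C \<in> Obj CC \<and> u \<in> carrier (F C)"
      using P'[THEN conjunct1] by blast
    show "\<And>C u v. \<lbrakk>P C u \<noteq> {}; v \<in> carrier (F C); v \<sqsubseteq>\<^bsub>F C\<^esub> u\<rbrakk> \<Longrightarrow> P C v \<noteq> {}"
      using P'[THEN conjunct2, THEN conjunct1] by blast
    show "\<And>C u f. \<lbrakk>f \<in> arrows_from CC C; P C u \<noteq> {}\<rbrakk> \<Longrightarrow> P (Cod CC f) (t f u) \<noteq> {}"
      using P'[THEN conjunct2, THEN conjunct2, THEN conjunct1] by blast
    show "\<And>C u S. \<lbrakk>C \<in> Obj CC; u \<in> carrier (F C); int_covers CC F t C u S;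
        \<forall>f\<in>arrows_from CC C. \<forall>v\<in>S f. P (Cod CC f) v \<noteq> {}\<rbrakk> \<Longrightarrow> P C u \<noteq> {}"
      using P'[THEN conjunct2, THEN conjunct2, THEN conjunct2] by blast
  qed
  \<comment> \<open>Values at identity arrows suffice: the value of \<open>I\<close> at
    \<open>f\<close> is the value of its transition along \<open>f\<close> at the identity of the
    codomain, so it is collected there.\<close>
  define W where "W C = (\<Union>I\<in>{I. P C I \<noteq> {}}. I (Id CC C))" for C
  define U where "U = (\<lambda>C\<in>Obj CC. rspec_gen (L C) (W C))"
  have Wc: "W C \<subseteq> carrier (L C)" if C: "C \<in> Obj CC" for C
  proof -
    have "I (Id CC C) \<subseteq> carrier (L C)" if "P C I \<noteq> {}" for I
      using carrier_F_E(2)[OF conjunct2[OF supp[OF that]] Id_arrows_from[OF C]] id_arr[OF C] by simp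
    then show ?thesis unfolding W_def by blast
  qed
  have Uo: "U C \<in> rspec_opens (L C)" if "C \<in> Obj CC" for C
    using rspec_gen_open[OF bounded Wc] that by (simp add: U_def)
  have WU: "W C \<subseteq> U C" if "C \<in> Obj CC" for C
    using rspec_gen_superset[of "W C"] that by (simp add: U_def)
  have IW: "I f \<subseteq> W (Cod CC f)" if f: "f \<in> arrows_from CC C" and I: "P C I \<noteq> {}" for C I f
  proof -
    have D: "Cod CC f \<in> Obj CC" using arrows_from_Obj[OF f] by auto
    have "t f I (Id CC (Cod CC f)) = I f"
      using Id_arrows_from[OF D] Comp_Id_left[OF f] by (simp add: int_rspec_map_def)
    then show ?thesis using trans[OF f I] unfolding W_def by auto
  qed
  have "h f ` U C \<subseteq> U (Cod CC f)" if f: "f \<in> arrows_from CC C" for C f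
  proof -
    have C: "C \<in> Obj CC" and D: "Cod CC f \<in> Obj CC" using arrows_from_Obj[OF f] by auto
    have "h f a \<in> U (Cod CC f)" if a: "a \<in> I (Id CC C)" "P C I \<noteq> {}" for a I
    proof -
      have "h f a \<in> I f"
        using carrier_F_E(3)[OF conjunct2[OF supp[OF a(2)]] Id_arrows_from[OF C] _ a(1), of f]
          f id_arr[OF C] Comp_Id_right[OF f] by simp
      then show ?thesis using IW[OF f a(2)] WU[OF D] by blast
    qed
    \<comment> \<open>Generators are mapped into \<open>U (Cod CC f)\<close>; since the preimage of
      that open is open, it contains the whole of \<open>U C\<close>.\<close>
    then have "W C \<subseteq> {a \<in> carrier (L C). h f a \<in> U (Cod CC f)}"
      using Wc[OF C] unfolding W_def by blast
    then have "U C \<subseteq> {a \<in> carrier (L C). h f a \<in> U (Cod CC f)}"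
      using rspec_gen_least[OF vimage_rspec_opens[OF f Uo[OF D]]] C by (simp add: U_def)
    then show ?thesis by blast
  qed
  then have U: "U \<in> families" unfolding families_iff using Uo by (auto simp: U_def)
  have le: "I \<sqsubseteq>\<^bsub>F C\<^esub> restrict_family U C" if "P C I \<noteq> {}" for C I
  proof -
    have "I f \<subseteq> U (Cod CC f)" if f: "f \<in> arrows_from CC C" for f
      using IW[OF f \<open>P C I \<noteq> {}\<close>] WU arrows_from_Obj[OF f] by blast
    then show ?thesis using le_restrict_family_iff supp[OF that] by blast
  qed
  \<comment> \<open>The sieve of all members of \<open>P\<close> at later stages covers
    \<open>restrict_family U C\<close>, so gluing places this element in \<open>P\<close>.\<close>
  have top: "P C (restrict_family U C) \<noteq> {}" if C: "C \<in> Obj CC" for C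
  proof (rule glue[OF C restrict_family_closed[OF U C]])
    let ?S = "\<lambda>f. {v. P (Cod CC f) v \<noteq> {}}"
    show "\<forall>f\<in>arrows_from CC C. \<forall>v\<in>?S f. P (Cod CC f) v \<noteq> {}" by auto
    have sv: "int_sieve CC F t C (restrict_family U C) ?S"
      unfolding int_sieve_def Let_def
    proof (intro ballI conjI impI; unfold mem_Collect_eq)
      fix f v assume f: "f \<in> arrows_from CC C" and v: "P (Cod CC f) v \<noteq> {}"
      show "v \<in> carrier (F (Cod CC f))" using supp[OF v] by blast
      show "v \<sqsubseteq>\<^bsub>F (Cod CC f)\<^esub> t f (restrict_family U C)"
        unfolding int_rspec_map_restrict_family[OF f] by (rule le[OF v])
      show "P (Cod CC f) w \<noteq> {}" if "w \<in> carrier (F (Cod CC f))" "w \<sqsubseteq>\<^bsub>F (Cod CC f)\<^esub> v" for w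
        by (rule down[OF v that])
      show "P (Cod CC (Comp CC g f)) (t g v) \<noteq> {}" if g: "g \<in> arrows_from CC (Cod CC f)" for g
        using trans[OF g v] Comp_arrows_from[OF f g] by simp
    qed
    have "t f (restrict_family U C) \<sqsubseteq>\<^bsub>F (Cod CC f)\<^esub> w"
      if f: "f \<in> arrows_from CC C" and w: "w \<in> carrier (F (Cod CC f))"
        and ub: "\<forall>g\<in>arrows_from CC (Cod CC f). \<forall>v\<in>?S (Comp CC g f). v \<sqsubseteq>\<^bsub>F (Cod CC g)\<^esub> t g w" for f w
    proof -
      have D: "Cod CC f \<in> Obj CC" using arrows_from_Obj[OF f] by auto
      \<comment> \<open>An upper bound \<open>w\<close> of the sieve contains at \<open>g\<close>
        the value of every member at the identity, that is, all generators of
        \<open>U (Cod CC g)\<close>; its component \<open>w g\<close> is open, so it contains what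
        they generate.\<close>
      have "U (Cod CC g) \<subseteq> w g" if g: "g \<in> arrows_from CC (Cod CC f)" for g
      proof -
        have E: "Cod CC g \<in> Obj CC" using arrows_from_Obj[OF g] by auto
        have "I (Id CC (Cod CC g)) \<subseteq> w g" if I: "P (Cod CC g) I \<noteq> {}" for I
        proof -
          have "I \<sqsubseteq>\<^bsub>F (Cod CC g)\<^esub> t g w" using ub g I Comp_arrows_from[OF f g] by auto
          then have "I (Id CC (Cod CC g)) \<subseteq> t g w (Id CC (Cod CC g))" unfolding le_F by blast
          then show ?thesis
            using Id_arrows_from[OF E] Comp_Id_left[OF g] by (simp add: int_rspec_map_def)
        qed
        then have "W (Cod CC g) \<subseteq> w g" unfolding W_def by blast
        moreover have "w g \<in> rspec_opens (L (Cod CC g))"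
          by (rule carrier_F_E(1)[OF w g])
        ultimately show ?thesis using rspec_gen_least E by (simp add: U_def)
      qed
      then show ?thesis
        unfolding int_rspec_map_restrict_family[OF f] le_F restrict_family_def by auto
    qed
    then show "int_covers CC F t C (restrict_family U C) ?S"
      unfolding int_covers_def using sv by blast
  qed
  have "P C I = family_open U C I" for C I
  proof -
    have "P C I \<noteq> {} \<longleftrightarrow> family_open U C I \<noteq> {}"
    proof
      assume "P C I \<noteq> {}"
      then show "family_open U C I \<noteq> {}" using supp le family_open_iff[of "()" U C I] by blast
    next
      assume "family_open U C I \<noteq> {}"
      then have "C \<in> Obj CC" "I \<in> carrier (F C)" "I \<sqsubseteq>\<^bsub>F C\<^esub> restrict_family U C"
        using family_open_iff[of "()" U C I] by auto
      then show "P C I \<noteq> {}" using top down by blast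
    qed
    \<comment> \<open>A set of elements of \<open>unit\<close> is determined by whether it is
      empty.\<close>
    moreover have "X = {} \<or> X = UNIV" for X :: "unit set" by auto
    ultimately show ?thesis by metis
  qed
  then have "P = family_open U" by blast
  with U that show thesis by blast
qed

theorem bij_betw_family_open: "bij_betw family_open families (topos_opens CC F t)"
proof (rule bij_betwI')
  fix U V assume UV: "U \<in> families" "V \<in> families"
  have "U = V" if "family_open U = family_open V"
  proof (rule PiE_ext)
    show "U \<in> (\<Pi>\<^sub>E C\<in>Obj CC. rspec_opens (L C))" "V \<in> (\<Pi>\<^sub>E C\<in>Obj CC. rspec_opens (L C))"
      using UV unfolding families_iff by auto
    show "U C = V C" if "C \<in> Obj CC" for C
      using family_open_mono_iff[OF UV] family_open_mono_iff[OF UV(2,1)]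
        \<open>family_open U = family_open V\<close> that by fastforce
  qed
  then show "family_open U = family_open V \<longleftrightarrow> U = V" by blast
next
  show "\<And>U. U \<in> families \<Longrightarrow> family_open U \<in> topos_opens CC F t"
    by (rule family_open_topos_open)
  show "\<And>P. P \<in> topos_opens CC F t \<Longrightarrow> \<exists>U\<in>families. P = family_open U"
    by (metis topos_open_family_open)
qed

end

section \<open>Opens of the internal Gelfand spectrum\<close>

lemma (in cstar_functor) cstar_hom_arr:
  "f \<in> Arr CC \<Longrightarrow> cstar_hom (A (Dom CC f)) (A (Cod CC f)) (\<alpha> f)"
  using algebra_obj hom_arr dom_cod by (simp add: cstar_hom_def cstar_hom_axioms_def)

lemma (in cstar_functor) interpolating_lattice_Lat:
  "interpolating_lattice CC (\<lambda>C. Lat (A C)) (\<lambda>f. Lat_map (A (Cod CC f)) (\<alpha> f))"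
proof (intro interpolating_lattice.intro interpolating_lattice_axioms.intro)
  show "small_category CC" by (rule small_category_axioms)
next
  fix C assume "C \<in> Obj CC"
  then show "bounded_lattice (Lat (A C))"
    by (rule unital_comm_cstar.bounded_lattice_Lat[OF algebra_obj])
next
  fix C X assume C: "C \<in> Obj CC" and "X \<in> carrier (Lat (A C))"
  then obtain t where t: "X = lclass (A C) t" "t \<in> lterms (A C)" by auto
  interpret unital_comm_cstar "A C" by (rule algebra_obj[OF C])
  \<comment> \<open>The map of an identity arrow is the identity only on the carrier, so the
    generators of \<open>t\<close> have to be compared one by one.\<close>
  have "map_lterm (\<alpha> (Id CC C)) t = map_lterm id t"
    using t(2) map_id[OF C] sa_closed by (intro lterm.map_cong) (auto simp: lterms_def)
  then show "Lat_map (A (Cod CC (Id CC C))) (\<alpha> (Id CC C)) X = X"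
    using cstar_hom.Lat_map_lclass[OF cstar_hom_arr, of "Id CC C" t] id_arr[OF C] t
    by (simp add: lterm.map_id)
next
  fix f assume f: "f \<in> Arr CC"
  interpret cstar_hom "A (Dom CC f)" "A (Cod CC f)" "\<alpha> f" by (rule cstar_hom_arr[OF f])
  show "Lat_map (A (Cod CC f)) (\<alpha> f) \<bottom>\<^bsub>Lat (A (Dom CC f))\<^esub> = \<bottom>\<^bsub>Lat (A (Cod CC f))\<^esub>"
    by (simp add: Lat_map_lclass)
  fix X assume X: "X \<in> carrier (Lat (A (Dom CC f)))"
  then obtain s where s: "X = lclass (A (Dom CC f)) s" "s \<in> lterms (A (Dom CC f))" by auto
  show "Lat_map (A (Cod CC f)) (\<alpha> f) X \<in> carrier (Lat (A (Cod CC f)))"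
    using s by (simp add: Lat_map_lclass hom_lterms)
  show "\<exists>Z. rather_below (Lat (A (Dom CC f))) Z X \<and>
      Y \<sqsubseteq>\<^bsub>Lat (A (Cod CC f))\<^esub> Lat_map (A (Cod CC f)) (\<alpha> f) Z"
    if "rather_below (Lat (A (Cod CC f))) Y (Lat_map (A (Cod CC f)) (\<alpha> f) X)" for Y
    by (rule Lat_map_interpolate[OF X that])
  fix Y assume "Y \<in> carrier (Lat (A (Dom CC f)))"
  then obtain t where t: "Y = lclass (A (Dom CC f)) t" "t \<in> lterms (A (Dom CC f))" by auto
  show "Lat_map (A (Cod CC f)) (\<alpha> f) (X \<squnion>\<^bsub>Lat (A (Dom CC f))\<^esub> Y) =
      Lat_map (A (Cod CC f)) (\<alpha> f) X \<squnion>\<^bsub>Lat (A (Cod CC f))\<^esub> Lat_map (A (Cod CC f)) (\<alpha> f) Y"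
    using s t by (simp add: Lat_map_lclass hom_lterms)
  show "Lat_map (A (Cod CC f)) (\<alpha> f) (X \<sqinter>\<^bsub>Lat (A (Dom CC f))\<^esub> Y) =
      Lat_map (A (Cod CC f)) (\<alpha> f) X \<sqinter>\<^bsub>Lat (A (Cod CC f))\<^esub> Lat_map (A (Cod CC f)) (\<alpha> f) Y"
    using s t by (simp add: Lat_map_lclass hom_lterms)
qed

theorem theorem24:
  fixes CC :: "('o, 'm) category" and A :: "'o \<Rightarrow> 'a cstar" and \<alpha> :: "'m \<Rightarrow> 'a \<Rightarrow> 'a"
  assumes "cstar_functor CC A \<alpha>"
  shows "bij_betw (open_of_family CC A \<alpha>) (compatible_families CC A \<alpha>) (gelfand_topos_opens CC A \<alpha>) \<and>
    (\<forall>U\<in>compatible_families CC A \<alpha>. \<forall>V\<in>compatible_families CC A \<alpha>.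
      (\<forall>C\<in>Obj CC. U C \<subseteq> V C) \<longleftrightarrow>
      (\<forall>C I. open_of_family CC A \<alpha> U C I \<subseteq> open_of_family CC A \<alpha> V C I))"
proof -
  interpret cstar_functor CC A \<alpha> by (rule assms)
  interpret interpolating_lattice CC "\<lambda>C. Lat (A C)" "\<lambda>f. Lat_map (A (Cod CC f)) (\<alpha> f)"
    by (rule interpolating_lattice_Lat)
  have "families = compatible_families CC A \<alpha>"
    by (simp add: families_def compatible_families_def)
  moreover have "family_open = open_of_family CC A \<alpha>"
    by (intro ext) (simp add: family_open_def open_of_family_def gelfand_frame_def)
  moreover have "topos_opens CC F t = gelfand_topos_opens CC A \<alpha>"
    by (simp add: gelfand_topos_opens_def gelfand_frame_def)
  ultimately show ?thesis
    using bij_betw_family_open family_open_mono_iff by simp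
qed

end
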